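(* Let $r,s>5$ be two relatively prime integers. Then there are infinitely many primes $p$ for which the group $\mathrm{PSL}(2,p)$ admits an unmixed Beauville structure $(x_1,y_1;x_2,y_2)$ such that $(x_1,y_1,(x_1y_1)^{-1})$ has type $(r,r,r)$ and $(x_2,y_2,(x_2y_2)^{-1})$ has type $(s,s,s)$.
   Context: $\mathrm{PSL}(2,p)$ denotes the quotient of the group $\mathrm{SL}(2,p)$ of $2\times 2$ matrices of determinant $1$ over the finite field with $p$ elements by its center. An unmixed Beauville structure for a finite group $G$ is a quadruple $(x_1,y_1;x_2,y_2)$ of elements of $G$ such that, setting $z_i:=(x_iy_i)^{-1}$ and $T_i:=(x_i,y_i,z_i)$ for $i=1,2$ (so that $x_iy_iz_i=1$), one has: (a) $\langle x_i,y_i\rangle=G$ for $i=1,2$; (b) $\Sigma(T_1)\cap\Sigma(T_2)=\{1\}$, where $$\Sigma(T_i):=\bigcup_{g\in G}\bigcup_{j=1}^{\infty}\{gx_i^jg^{-1},\,gy_i^jg^{-1},\,gz_i^jg^{-1}\}.$$ The type of a triple $(x,y,z)$ of elements of $G$ is the triple of their orders $(\mathrm{ord}(x),\mathrm{ord}(y),\mathrm{ord}(z))$. *)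

theory Defs
  imports
    "HOL-Algebra.Algebra"
    "HOL-Number_Theory.Number_Theory"
    "Jordan_Normal_Form.Determinant"
begin

hide_const (open) Divisibility.prime

section \<open>The groups PSL(n, p)\<close>

text \<open>
  The prime \<open>p\<close> is a bound variable in the intended use, so it cannot be a type parameter: the field with
  \<open>p\<close> elements is \<^term>\<open>residue_ring (int p)\<close>, with carrier \<open>{0..p - 1}\<close>, and matrices over it
  are integer matrices with entries in that carrier. Its operations are the integer operations
  followed by reduction modulo \<open>p\<close>, hence the entrywise reduction in the matrix product.
\<close>

definition mat_mod :: "nat \<Rightarrow> int mat \<Rightarrow> int mat"
  where "mat_mod p A = map_mat (\<lambda>a. a mod int p) A"

definition SL :: "nat \<Rightarrow> nat \<Rightarrow> int mat monoid"
  where "SL n p =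
    \<lparr>carrier = {A \<in> carrier_mat n n.
        elements_mat A \<subseteq> carrier (residue_ring (int p)) \<and> [det A = 1] (mod int p)},
     monoid.mult = (\<lambda>A B. mat_mod p (A * B)),
     one = 1\<^sub>m n\<rparr>"

definition center :: "('a, 'b) monoid_scheme \<Rightarrow> 'a set"
  where "center G = {z \<in> carrier G. \<forall>g \<in> carrier G. z \<otimes>\<^bsub>G\<^esub> g = g \<otimes>\<^bsub>G\<^esub> z}"

definition PSL :: "nat \<Rightarrow> nat \<Rightarrow> int mat set monoid"
  where "PSL n p = SL n p Mod center (SL n p)"

lemma mat_mod_index [simp]:
  "i < dim_row A \<Longrightarrow> j < dim_col A \<Longrightarrow> mat_mod p A $$ (i, j) = A $$ (i, j) mod int p"
  "dim_row (mat_mod p A) = dim_row A" "dim_col (mat_mod p A) = dim_col A"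
  by (simp_all add: mat_mod_def)

lemma mat_mod_carrier [simp]: "mat_mod p A \<in> carrier_mat n m \<longleftrightarrow> A \<in> carrier_mat n m"
  unfolding mat_mod_def by (rule map_carrier_mat)

lemma det_mat_mod:
  assumes "A \<in> carrier_mat n n"
  shows "[det (mat_mod p A) = det A] (mod int p)"
proof -
  have "[(\<Prod>i = 0..<n. mat_mod p A $$ (i, q i)) = (\<Prod>i = 0..<n. A $$ (i, q i))] (mod int p)"
    if "q permutes {0..<n}" for q
    using assms that by (intro cong_prod) (auto simp: permutes_in_image cong_def)
  then show ?thesis
    using assms by (auto simp: det_def'[of _ n] intro!: cong_sum cong_scalar_left)
qed

lemma mat_mod_mult_left:
  assumes "A \<in> carrier_mat n m" "B \<in> carrier_mat m k"
  shows "mat_mod p (mat_mod p A * B) = mat_mod p (A * B)"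
proof (rule eq_matI)
  fix i j assume "i < dim_row (mat_mod p (A * B))" "j < dim_col (mat_mod p (A * B))"
  moreover have "[(\<Sum>l = 0..<m. (A $$ (i, l) mod int p) * B $$ (l, j)) =
      (\<Sum>l = 0..<m. A $$ (i, l) * B $$ (l, j))] (mod int p)"
    by (intro cong_sum cong_mult) (auto simp: cong_def)
  ultimately show "mat_mod p (mat_mod p A * B) $$ (i, j) = mat_mod p (A * B) $$ (i, j)"
    using assms by (auto simp: scalar_prod_def cong_def)
qed (use assms in auto)

lemma mat_mod_mult_right:
  assumes "A \<in> carrier_mat n m" "B \<in> carrier_mat m k"
  shows "mat_mod p (A * mat_mod p B) = mat_mod p (A * B)"
proof (rule eq_matI)
  fix i j assume "i < dim_row (mat_mod p (A * B))" "j < dim_col (mat_mod p (A * B))"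
  moreover have "[(\<Sum>l = 0..<m. A $$ (i, l) * (B $$ (l, j) mod int p)) =
      (\<Sum>l = 0..<m. A $$ (i, l) * B $$ (l, j))] (mod int p)"
    by (intro cong_sum cong_mult) (auto simp: cong_def)
  ultimately show "mat_mod p (A * mat_mod p B) $$ (i, j) = mat_mod p (A * B) $$ (i, j)"
    using assms by (auto simp: scalar_prod_def cong_def)
qed (use assms in auto)

lemma carrier_SL:
  "A \<in> carrier (SL n p) \<longleftrightarrow> A \<in> carrier_mat n n \<and>
     (\<forall>i < n. \<forall>j < n. A $$ (i, j) \<in> {0..int p - 1}) \<and> [det A = 1] (mod int p)"
proof -
  have "elements_mat A \<subseteq> {0..int p - 1} \<longleftrightarrow> (\<forall>i < n. \<forall>j < n. A $$ (i, j) \<in> {0..int p - 1})"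
    if A: "A \<in> carrier_mat n n"
  proof
    show "\<forall>i < n. \<forall>j < n. A $$ (i, j) \<in> {0..int p - 1}" if "elements_mat A \<subseteq> {0..int p - 1}"
      using that elements_matI[OF A _ _ refl] by blast
    show "elements_mat A \<subseteq> {0..int p - 1}" if "\<forall>i < n. \<forall>j < n. A $$ (i, j) \<in> {0..int p - 1}"
      using that A by (auto dest!: elements_matD)
  qed
  then show ?thesis
    unfolding SL_def residue_ring_def by auto
qed

lemma mat_mod_id: "A \<in> carrier (SL n p) \<Longrightarrow> mat_mod p A = A"
  by (rule eq_matI) (auto simp: carrier_SL)

lemma mat_mod_in_SL:
  assumes "p > 0" "A \<in> carrier_mat n n" "[det A = 1] (mod int p)"
  shows "mat_mod p A \<in> carrier (SL n p)"
  using assms cong_trans[OF det_mat_mod assms(3)] by (auto simp: carrier_SL)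

lemma group_SL:
  assumes "p > 1"
  shows "group (SL n p)"
proof (rule groupI)
  fix A B assume A: "A \<in> carrier (SL n p)" and B: "B \<in> carrier (SL n p)"
  then have "[det A * det B = 1 * 1] (mod int p)"
    by (intro cong_mult) (auto simp: carrier_SL)
  moreover have AB: "A * B \<in> carrier_mat n n"
    using A B unfolding carrier_SL by (blast intro: mult_carrier_mat)
  ultimately have "[det (A * B) = 1] (mod int p)"
    using A B
    by (simp add: carrier_SL det_mult[of A n B])
  with AB show "A \<otimes>\<^bsub>SL n p\<^esub> B \<in> carrier (SL n p)"
    using mat_mod_in_SL[of p "A * B" n] AB assms by (simp add: SL_def)
next
  show "\<one>\<^bsub>SL n p\<^esub> \<in> carrier (SL n p)"
    using assms by (simp add: carrier_SL) (simp add: SL_def)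
next
  fix A B C assume "A \<in> carrier (SL n p)" "B \<in> carrier (SL n p)" "C \<in> carrier (SL n p)"
  then have "A \<in> carrier_mat n n" "B \<in> carrier_mat n n" "C \<in> carrier_mat n n"
    by (auto simp: carrier_SL)
  then show "A \<otimes>\<^bsub>SL n p\<^esub> B \<otimes>\<^bsub>SL n p\<^esub> C = A \<otimes>\<^bsub>SL n p\<^esub> (B \<otimes>\<^bsub>SL n p\<^esub> C)"
    by (simp add: SL_def mat_mod_mult_left[of _ n n _ n] mat_mod_mult_right[of _ n n _ n])
next
  fix A assume "A \<in> carrier (SL n p)"
  then show "\<one>\<^bsub>SL n p\<^esub> \<otimes>\<^bsub>SL n p\<^esub> A = A"
    using mat_mod_id[of A n p] left_mult_one_mat[of A n n] by (simp add: SL_def)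
next
  fix A assume A: "A \<in> carrier (SL n p)"
  then have c: "A \<in> carrier_mat n n" and d: "[det A = 1] (mod int p)" by (auto simp: carrier_SL)
  note adj = adj_mat[OF c]
  have "det A * det (adj_mat A) = det A ^ n"
    using det_mult[OF c adj(1)] adj(2) by simp
  moreover have "[det A * det (adj_mat A) = 1 * det (adj_mat A)] (mod int p)"
    "[det A ^ n = 1 ^ n] (mod int p)"
    using cong_scalar_right[OF d] cong_pow[OF d] by blast+
  ultimately have "[det (adj_mat A) = 1] (mod int p)"
    by (metis cong_sym cong_trans mult_1 power_one)
  then have "mat_mod p (adj_mat A) \<in> carrier (SL n p)"
    using assms adj(1) by (intro mat_mod_in_SL) auto
  moreover have "mat_mod p (det A \<cdot>\<^sub>m 1\<^sub>m n) = 1\<^sub>m n"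
    using d assms by (intro eq_matI) (auto simp: cong_def)
  then have "mat_mod p (mat_mod p (adj_mat A) * A) = 1\<^sub>m n"
    using adj c by (simp add: mat_mod_mult_left[of _ n n _ n])
  ultimately show "\<exists>B \<in> carrier (SL n p). B \<otimes>\<^bsub>SL n p\<^esub> A = \<one>\<^bsub>SL n p\<^esub>"
    by (intro bexI) (auto simp: SL_def)
qed

lemma (in group) center_normal: "center G \<lhd> G"
proof -
  have comm_inv: "inv a \<otimes> g = g \<otimes> inv a"
    if "a \<in> carrier G" "g \<in> carrier G" "a \<otimes> g = g \<otimes> a" for a g
  proof -
    have "inv a \<otimes> g = inv a \<otimes> (g \<otimes> a) \<otimes> inv a"
      using that(1,2) by (simp add: m_assoc)
    also have "\<dots> = g \<otimes> inv a"
      using that(1,2) by (simp add: that(3)[symmetric] m_assoc[symmetric])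
    finally show ?thesis .
  qed
  have comm_mult: "a \<otimes> b \<otimes> g = g \<otimes> (a \<otimes> b)"
    if "a \<in> carrier G" "b \<in> carrier G" "g \<in> carrier G" "a \<otimes> g = g \<otimes> a" "b \<otimes> g = g \<otimes> b" for a b g
  proof -
    have "a \<otimes> b \<otimes> g = a \<otimes> (b \<otimes> g)" using that(1-3) by (rule m_assoc)
    also have "\<dots> = (a \<otimes> g) \<otimes> b" using that(1-3) by (simp add: that(5) m_assoc)
    also have "\<dots> = g \<otimes> (a \<otimes> b)" using that(1-3) by (simp add: that(4) m_assoc)
    finally show ?thesis .
  qed
  have sub: "subgroup (center G) G"
  proof (rule subgroupI)
    show "center G \<noteq> {}" unfolding center_def using one_closed by force
    show "inv a \<in> center G" if "a \<in> center G" for a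
      using that comm_inv inv_closed unfolding center_def by blast
    show "a \<otimes> b \<in> center G" if "a \<in> center G" "b \<in> center G" for a b
      using that comm_mult m_closed unfolding center_def by blast
  qed (unfold center_def, blast)
  have "g \<otimes> h \<otimes> inv g \<in> center G" if "g \<in> carrier G" "h \<in> center G" for g h
  proof -
    have h: "h \<in> carrier G" "h \<otimes> g = g \<otimes> h" using that by (auto simp: center_def)
    have "g \<otimes> h \<otimes> inv g = h"
      using that(1) h(1) by (simp add: h(2)[symmetric] m_assoc)
    then show ?thesis using that(2) by simp
  qed
  with sub show ?thesis
    using normal_inv_iff by blast
qed

lemma group_PSL: "p > 1 \<Longrightarrow> group (PSL n p)"
  unfolding PSL_def by (intro normal.factorgroup_is_group group.center_normal group_SL)


section \<open>Unmixed Beauville structures\<close>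

definition beauville_triple :: "('a, 'b) monoid_scheme \<Rightarrow> 'a \<Rightarrow> 'a \<Rightarrow> 'a \<times> 'a \<times> 'a"
  where "beauville_triple G x y = (x, y, inv\<^bsub>G\<^esub> (x \<otimes>\<^bsub>G\<^esub> y))"

fun beauville_Sigma :: "('a, 'b) monoid_scheme \<Rightarrow> 'a \<times> 'a \<times> 'a \<Rightarrow> 'a set"
  where "beauville_Sigma G (x, y, z) =
    (\<Union>g \<in> carrier G. \<Union>j \<in> {1::nat..}.
      {g \<otimes>\<^bsub>G\<^esub> (x [^]\<^bsub>G\<^esub> j) \<otimes>\<^bsub>G\<^esub> inv\<^bsub>G\<^esub> g,
       g \<otimes>\<^bsub>G\<^esub> (y [^]\<^bsub>G\<^esub> j) \<otimes>\<^bsub>G\<^esub> inv\<^bsub>G\<^esub> g,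
       g \<otimes>\<^bsub>G\<^esub> (z [^]\<^bsub>G\<^esub> j) \<otimes>\<^bsub>G\<^esub> inv\<^bsub>G\<^esub> g})"

fun triple_type :: "('a, 'b) monoid_scheme \<Rightarrow> 'a \<times> 'a \<times> 'a \<Rightarrow> nat \<times> nat \<times> nat"
  where "triple_type G (x, y, z) = (group.ord G x, group.ord G y, group.ord G z)"

definition unmixed_beauville_structure ::
  "('a, 'b) monoid_scheme \<Rightarrow> 'a \<Rightarrow> 'a \<Rightarrow> 'a \<Rightarrow> 'a \<Rightarrow> bool"
  where "unmixed_beauville_structure G x1 y1 x2 y2 \<longleftrightarrow>
    group G \<and> finite (carrier G) \<and>
    {x1, y1, x2, y2} \<subseteq> carrier G \<and>
    generate G {x1, y1} = carrier G \<and>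
    generate G {x2, y2} = carrier G \<and>
    beauville_Sigma G (beauville_triple G x1 y1) \<inter> beauville_Sigma G (beauville_triple G x2 y2)
      = {\<one>\<^bsub>G\<^esub>}"

end

theory Submission
  imports Defs "Jordan_Normal_Form.Char_Poly"
begin

text \<open>
  Take a prime \<open>p\<close> for which some residue has multiplicative order \<open>2rs\<close>, and let \<open>\<zeta>\<close> be a residue
  of order \<open>2r\<close>. There is a matrix \<open>y\<close>, with upper right entry 1, such that \<open>x = diag(\<zeta>, 1/\<zeta>)\<close>,
  \<open>y\<close> and \<open>xy\<close> all have trace \<open>\<zeta> + 1/\<zeta>\<close>. By Cayley-Hamilton, which powers of a nonscalar matrix of
  determinant 1 are scalar depends only on its trace, so the three elements have order \<open>r\<close> in
  \<open>PSL(2, p)\<close>.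

  Let \<open>H\<close> be generated by \<open>x\<close>, \<open>y\<close> and the center. If \<open>H\<close> contains a nonscalar matrix of trace
  \<open>2\<close> or \<open>-2\<close>, then it contains all transvections in two independent directions and is everything.
  Otherwise the centralizers of the noncentral elements of \<open>H\<close> partition \<open>H\<close> away from the center,
  each having index at most 2 in its normalizer. Comparing the sizes of the conjugacy classes of
  centralizers with that of \<open>H\<close>, as in Dickson's classification of the subgroups of \<open>PSL(2, p)\<close>, shows
  that \<open>x\<close> and \<open>y\<close> commute, because \<open>x\<close> has at least 12 powers and \<open>y\<^sup>2\<close> is not central; but they
  do not commute. Since \<open>r\<close> and \<open>s\<close> are coprime, the two sets \<open>\<Sigma>\<close> meet trivially.
\<close>

section \<open>Primes with a residue of given order\<close>

text \<open>Every term is 1 modulo \<open>p\<close>, so the sum is congruent to \<open>e\<close>.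
  The sum is the cofactor of \<open>a - 1\<close> in \<open>a ^ e - 1\<close>.\<close>

lemma dvd_geometric_sum_coprime:
  fixes a p :: int
  assumes "prime p" "\<not> p dvd int e" "[a = 1] (mod p)"
  shows "coprime p (\<Sum>i<e. a ^ i)"
proof -
  have "[(\<Sum>i<e. a ^ i) = (\<Sum>i<e. 1 ^ i)] (mod p)"
    by (intro cong_sum cong_pow assms)
  then have "\<not> p dvd (\<Sum>i<e. a ^ i)"
    using assms(2) by (simp add: cong_dvd_iff)
  then show ?thesis
    using assms(1) by (simp add: prime_imp_coprime)
qed

lemma abs_poly_le:
  fixes R :: "int poly"
  assumes "R = 0 \<or> degree R < n" "a \<ge> 1"
  shows "\<bar>poly R a\<bar> \<le> (\<Sum>i\<le>degree R. \<bar>coeff R i\<bar>) * a ^ (n - 1)"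
proof -
  have "\<bar>coeff R i * a ^ i\<bar> \<le> \<bar>coeff R i\<bar> * a ^ (n - 1)" if "i \<le> degree R" for i
  proof (cases "R = 0")
    case False
    then have "a ^ i \<le> a ^ (n - 1)"
      using that assms by (intro power_increasing) auto
    then show ?thesis
      using assms(2) by (simp add: abs_mult mult_left_mono)
  qed simp
  then have "(\<Sum>i\<le>degree R. \<bar>coeff R i * a ^ i\<bar>) \<le> (\<Sum>i\<le>degree R. \<bar>coeff R i\<bar> * a ^ (n - 1))"
    by (intro sum_mono) auto
  then show ?thesis
    unfolding poly_altdef sum_distrib_right by (rule order_trans[OF sum_abs])
qed

lemma primitive_root_of_unity_power_neq_1:
  assumes "0 < d" "d < n"
  shows "cis (2 * pi / real n) ^ d \<noteq> 1"
proof
  assume "cis (2 * pi / real n) ^ d = 1"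
  then have "cis (real d * (2 * pi / real n)) = 1"
    by (simp add: DeMoivre)
  then have "cos (real d * (2 * pi / real n)) = 1"
    by (simp add: complex_eq_iff)
  then obtain k :: int where "real d * (2 * pi / real n) = real_of_int k * 2 * pi"
    using cos_one_2pi_int by auto
  then have "real d = real_of_int k * real n"
    using assms by (simp add: field_simps)
  then have "int d = k * int n"
    by (metis of_int_eq_iff of_int_mult of_int_of_nat_eq)
  then have "n dvd d"
    by (metis dvd_triv_right int_dvd_int_iff)
  with assms show False
    using dvd_imp_le by force
qed

text \<open>Modulo \<open>X ^ n - 1\<close> the product leaves a remainder that does not vanish at a primitive \<open>n\<close>-th
  root of unity; its degree is less than \<open>n\<close>, so at large arguments it is too small to be divisible.\<close>

lemma ex_large_not_dvd_prod:
  fixes n :: nat and m :: int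
  assumes n: "n > 0" and m: "m > 0"
  shows "\<exists>a::int. a > 1 \<and> m dvd a \<and> \<not> a ^ n - 1 dvd (\<Prod>d\<in>{d. d dvd n \<and> d < n}. a ^ d - 1)"
proof -
  define D where "D = {d. d dvd n \<and> d < n}"
  define f :: "int poly" where "f = monom 1 n - 1"
  define g :: "int poly" where "g = (\<Prod>d\<in>D. monom 1 d - 1)"
  have D: "0 < d \<and> d < n" if "d \<in> D" for d
    using that n unfolding D_def by (auto intro: Nat.gr0I)
  have fin: "finite D" unfolding D_def using n by simp
  have deg: "degree f = n" and lead: "lead_coeff f = 1"
  proof -
    have "degree (monom (1::int) n + (- 1)) = degree (monom (1::int) n)"
      using n by (intro degree_add_eq_left) (simp add: degree_monom_eq)
    then show "degree f = n" unfolding f_def by (simp add: degree_monom_eq)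
    then show "lead_coeff f = 1" using n unfolding f_def by simp
  qed
  then have "f \<noteq> 0" by auto
  \<comment> \<open>Since \<open>f\<close> is monic, pseudo-division over the integers is division
    with remainder.\<close>
  obtain q R where qR: "pseudo_divmod g f = (q, R)" by force
  have g: "g = f * q + R" and R: "R = 0 \<or> degree R < n"
    using pseudo_divmod[OF \<open>f \<noteq> 0\<close> qR] lead deg by auto
  have "R \<noteq> 0"
  proof
    assume "R = 0"
    define w where "w = cis (2 * pi / real n)"
    have "of_int_poly g = (of_int_poly f * of_int_poly q :: complex poly)"
      using g \<open>R = 0\<close> by (simp add: of_int_poly_hom.hom_mult)
    moreover have "poly (of_int_poly f) w = 0"
      using n by (simp add: f_def w_def of_int_poly_hom.hom_minus poly_monom DeMoivre)
    ultimately have "poly (of_int_poly g) w = 0" by simp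
    then have "(\<Prod>d\<in>D. w ^ d - 1) = 0"
      by (simp add: g_def of_int_poly_hom.hom_prod of_int_poly_hom.hom_minus poly_prod poly_monom)
    then show False
      using primitive_root_of_unity_power_neq_1 D fin by (auto simp: w_def)
  qed
  then have "finite {x. poly R x = 0}" by (rule poly_roots_finite)
  then obtain B where B: "\<And>x. poly R x = 0 \<Longrightarrow> x \<le> B"
    by (metis (mono_tags, lifting) bdd_above_def bdd_above_finite mem_Collect_eq)
  define C where "C = (\<Sum>i\<le>degree R. \<bar>coeff R i\<bar>)"
  \<comment> \<open>A multiple of \<open>m\<close> beyond every root of \<open>R\<close> and at
    least \<open>C + 2\<close>: then \<open>poly R a\<close> is nonzero, but smaller in absolute
    value than \<open>a ^ n - 1\<close>.\<close>
  define a where "a = m * (\<bar>B\<bar> + C + 2)"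
  have "C \<ge> 0" unfolding C_def by (simp add: sum_nonneg)
  have "1 * (\<bar>B\<bar> + C + 2) \<le> a"
    unfolding a_def using m \<open>C \<ge> 0\<close> by (intro mult_right_mono) auto
  then have a: "a \<ge> C + 2" "a > B" "a > 1"
    using \<open>C \<ge> 0\<close> by auto
  have "poly f a = a ^ n - 1" "poly g a = (\<Prod>d\<in>D. a ^ d - 1)"
    by (simp_all add: f_def g_def poly_prod poly_monom)
  moreover have "\<not> a ^ n - 1 dvd poly R a"
  proof
    assume "a ^ n - 1 dvd poly R a"
    moreover have "poly R a \<noteq> 0" using B a by force
    ultimately have "a ^ n - 1 \<le> \<bar>poly R a\<bar>"
      by (meson dvd_abs_iff zdvd_imp_le zero_less_abs_iff)
    also have "\<dots> \<le> C * a ^ (n - 1)"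
      using abs_poly_le[OF R] a unfolding C_def by simp
    also have "\<dots> \<le> (a - 2) * a ^ (n - 1)"
      using a by (intro mult_right_mono) auto
    also have "\<dots> = a ^ n - 2 * a ^ (n - 1)"
      using n by (cases n) (auto simp: algebra_simps)
    finally have "2 * a ^ (n - 1) \<le> 1" by simp
    moreover have "a ^ (n - 1) \<ge> 1" using a by simp
    ultimately show False by linarith
  qed
  ultimately have "\<not> a ^ n - 1 dvd (\<Prod>d\<in>D. a ^ d - 1)"
    using arg_cong[OF g, of "\<lambda>h. poly h a", symmetric] by (metis dvd_add_right_iff dvd_triv_left poly_add poly_mult)
  moreover have "m dvd a" unfolding a_def by simp
  ultimately show ?thesis using a unfolding D_def by blast
qed

text \<open>A prime that divides \<open>a ^ n - 1\<close> but no \<open>a ^ d - 1\<close> with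
  \<open>d\<close> a proper divisor of \<open>n\<close> gives order \<open>n\<close>. Without such a
  prime, each prime power in \<open>a ^ n - 1\<close> would divide a single factor of the product
  over \<open>D\<close>, and \<open>a ^ n - 1\<close> would divide the product. For this, primes
  dividing \<open>a ^ n - 1\<close> must not divide \<open>n\<close>, which holds as
  \<open>n\<close> divides \<open>a\<close>. Likewise \<open>fact N\<close> divides
  \<open>a\<close>, so that primes up to \<open>N\<close> are excluded.\<close>

theorem ex_large_prime_ord:
  fixes n N :: nat
  assumes n: "n > 0"
  shows "\<exists>p > N. prime p \<and> (\<exists>a. ord p a = n)"
proof -
  define D where "D = {d. d dvd n \<and> d < n}"
  obtain a :: int where a: "a > 1" "int (n * fact N) dvd a"
    and nd: "\<not> a ^ n - 1 dvd (\<Prod>d\<in>D. a ^ d - 1)"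
    using ex_large_not_dvd_prod[OF n, of "int (n * fact N)"] n unfolding D_def by auto
  have D: "0 < d \<and> d < n \<and> d dvd n" if "d \<in> D" for d
    using that n unfolding D_def by (auto intro: Nat.gr0I)
  have fin: "finite D" unfolding D_def using n by simp
  have pos: "a ^ d - 1 \<noteq> 0" if "d > 0" for d
    using a that by (metis diff_eq_eq add_0 less_numeral_extra(4) one_less_power)
  have "\<exists>p. prime p \<and> p dvd a ^ n - 1 \<and> (\<forall>d\<in>D. \<not> p dvd a ^ d - 1)"
  proof (rule ccontr)
    assume no: "\<not> ?thesis"
    have "a ^ n - 1 dvd (\<Prod>d\<in>D. a ^ d - 1)"
    proof (rule multiplicity_le_imp_dvd)
      show "a ^ n - 1 \<noteq> 0" using pos n by blast
      fix p :: int assume p: "prime p"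
      define k where "k = multiplicity p (a ^ n - 1)"
      have pk: "p ^ k dvd a ^ n - 1" unfolding k_def by (rule multiplicity_dvd)
      show "multiplicity p (a ^ n - 1) \<le> multiplicity p (\<Prod>d\<in>D. a ^ d - 1)"
      proof (cases "p dvd a ^ n - 1")
        case False
        then show ?thesis by (simp add: not_dvd_imp_multiplicity_0)
      next
        case True
        with no p obtain d where d: "d \<in> D" "p dvd a ^ d - 1" by blast
        obtain e where e: "n = d * e" using D[OF d(1)] by blast
        have "\<not> p dvd a"
        proof
          assume "p dvd a"
          then have "p dvd a ^ n" using n by (simp add: dvd_power dvd_trans)
          with True have "p dvd 1" by (metis dvd_diff_right_iff)
          with p show False by (simp add: not_prime_unit)
        qed
        then have "\<not> p dvd int n"
          using a(2) by (metis dvd_mult2 dvd_trans of_nat_mult dvd_mult_left)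
        then have "\<not> p dvd int e" by (auto simp: e)
        then have "coprime (p ^ k) (\<Sum>i<e. (a ^ d) ^ i)"
          using d(2) p by (intro coprime_power_left_iff[THEN iffD2] disjI1 dvd_geometric_sum_coprime)
            (auto simp: cong_iff_dvd_diff)
        moreover have "a ^ n - 1 = (a ^ d - 1) * (\<Sum>i<e. (a ^ d) ^ i)"
          by (simp add: e power_mult power_diff_1_eq)
        ultimately have "p ^ k dvd a ^ d - 1"
          using pk by (simp add: coprime_dvd_mult_left_iff)
        then have "p ^ k dvd (\<Prod>d\<in>D. a ^ d - 1)"
          by (rule dvd_trans[OF _ dvd_prodI[OF fin d(1)]])
        moreover have "(\<Prod>d\<in>D. a ^ d - 1) \<noteq> 0"
          using fin pos D by simp
        ultimately show ?thesis
          using p unfolding k_def by (intro multiplicity_geI) auto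
      qed
    qed
    with nd show False ..
  qed
  then obtain q :: int where q: "prime q" "q dvd a ^ n - 1" "\<And>d. d \<in> D \<Longrightarrow> \<not> q dvd a ^ d - 1"
    by blast
  define p b where "p = nat q" and "b = nat a"
  have pb: "q = int p" "a = int b"
    using q a prime_ge_0_int by (auto simp: p_def b_def)
  have "prime p" using q(1) pb by simp
  have iff: "q dvd a ^ d - 1 \<longleftrightarrow> [b ^ d = 1] (mod p)" for d
    by (simp add: pb cong_iff_dvd_diff flip: cong_int_iff)
  have "ord p b dvd n"
    using q(2) by (metis iff ord_divides)
  moreover have "ord p b \<notin> D"
    using q(3)[of "ord p b"] iff[of "ord p b"] ord_works[of b p] by blast
  ultimately have "ord p b = n"
    using n unfolding D_def by (auto dest: dvd_imp_le)
  moreover have "p > N"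
  proof (rule ccontr)
    assume "\<not> p > N"
    then have "p dvd fact N"
      using \<open>prime p\<close> by (simp add: prime_dvd_fact_iff)
    then have "p dvd b"
      using a(2) by (metis dvd_mult_right dvd_trans int_dvd_int_iff pb(2))
    then have "\<not> coprime p b"
      using \<open>prime p\<close> by (metis coprime_absorb_left not_prime_unit)
    with \<open>ord p b = n\<close> n show False by (simp add: ord_eq_0)
  qed
  ultimately show ?thesis using \<open>prime p\<close> by blast
qed


section \<open>Groups partitioned by their centralizers\<close>

text \<open>These are properties of a subgroup of SL(2, p) that contains \<open>Z\<close>, the set
  of 1 and -1, and has no element of trace 2 or -2 outside \<open>Z\<close>. By
  \<open>comm_trans\<close> commuting is an equivalence relation outside \<open>Z\<close>;
  \<open>conj_commuting\<close> and \<open>involution\<close> control the normalizers of its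
  classes.\<close>

locale torus_group = group G for G (structure) +
  fixes Z :: "'a set"
  assumes finite_carrier: "finite (carrier G)"
    and Z_subgroup: "subgroup Z G"
    and card_Z: "card Z = 2"
    and Z_central: "\<lbrakk>z \<in> Z; g \<in> carrier G\<rbrakk> \<Longrightarrow> z \<otimes> g = g \<otimes> z"
    and comm_trans: "\<lbrakk>a \<in> carrier G - Z; b \<in> carrier G - Z; c \<in> carrier G - Z;
      a \<otimes> b = b \<otimes> a; b \<otimes> c = c \<otimes> b\<rbrakk> \<Longrightarrow> a \<otimes> c = c \<otimes> a"
    and conj_commuting: "\<lbrakk>a \<in> carrier G - Z; h \<in> carrier G;
      (h \<otimes> a \<otimes> inv h) \<otimes> a = a \<otimes> (h \<otimes> a \<otimes> inv h)\<rbrakk> \<Longrightarrow> h \<otimes> a \<otimes> inv h \<in> {a, inv a}"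
    and involution: "\<lbrakk>a \<in> carrier G; a \<otimes> a = \<one>\<rbrakk> \<Longrightarrow> a \<in> Z"
begin

abbreviation "noncentral \<equiv> carrier G - Z"

definition conjugate :: "'a \<Rightarrow> 'a \<Rightarrow> 'a" where "conjugate h a = h \<otimes> a \<otimes> inv h"

definition commutes :: "'a \<Rightarrow> 'a \<Rightarrow> bool" where "commutes a b \<longleftrightarrow> a \<otimes> b = b \<otimes> a"

text \<open>Leaving out \<open>Z\<close> makes the tori of two elements outside \<open>Z\<close>
  equal or disjoint.\<close>

definition torus :: "'a \<Rightarrow> 'a set" where "torus a = {b \<in> noncentral. commutes b a}"

text \<open>This is the normalizer of \<open>torus a\<close>, because commuting is transitive on noncentral elements.\<close>

definition torus_normalizer :: "'a \<Rightarrow> 'a set" where "torus_normalizer a = {h \<in> carrier G. commutes (conjugate h a) a}"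

text \<open>The union of the conjugates of \<open>torus a\<close>, written as an image of pairs so
  that it can be counted by fibres.\<close>

definition torus_class :: "'a \<Rightarrow> 'a set" where "torus_class a = (\<lambda>(h, b). conjugate h b) ` (carrier G \<times> torus a)"

definition centralizer :: "'a \<Rightarrow> 'a set" where "centralizer a = {b \<in> carrier G. commutes b a}"

section \<open>Conjugation and commuting\<close>

lemma Z_carrier: "z \<in> Z \<Longrightarrow> z \<in> carrier G"
  by (rule subgroup.mem_carrier[OF Z_subgroup])

lemma conjugate_closed [simp]: "h \<in> carrier G \<Longrightarrow> a \<in> carrier G \<Longrightarrow> conjugate h a \<in> carrier G"
  by (simp add: conjugate_def)

lemma conjugate_one [simp]: "a \<in> carrier G \<Longrightarrow> conjugate \<one> a = a"
  by (simp add: conjugate_def)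

lemma conjugate_conjugate:
  "\<lbrakk>h \<in> carrier G; k \<in> carrier G; a \<in> carrier G\<rbrakk> \<Longrightarrow> conjugate h (conjugate k a) = conjugate (h \<otimes> k) a"
  by (simp add: conjugate_def m_assoc inv_mult_group)

lemma conjugate_inv_cancel [simp]:
  "\<lbrakk>h \<in> carrier G; a \<in> carrier G\<rbrakk> \<Longrightarrow> conjugate (inv h) (conjugate h a) = a"
  "\<lbrakk>h \<in> carrier G; a \<in> carrier G\<rbrakk> \<Longrightarrow> conjugate h (conjugate (inv h) a) = a"
  by (simp_all add: conjugate_conjugate)

lemma conjugate_eq_self_iff:
  assumes "h \<in> carrier G" "a \<in> carrier G"
  shows "conjugate h a = a \<longleftrightarrow> commutes h a"
  using assms by (metis (no_types, lifting) commutes_def conjugate_def inv_solve_right m_closed)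

lemma conjugate_mult:
  assumes "h \<in> carrier G" "a \<in> carrier G" "b \<in> carrier G"
  shows "conjugate h (a \<otimes> b) = conjugate h a \<otimes> conjugate h b"
proof -
  have "inv h \<otimes> (h \<otimes> c) = c" if "c \<in> carrier G" for c
    using assms that by (simp add: m_assoc[symmetric])
  then show ?thesis unfolding conjugate_def using assms by (simp add: m_assoc)
qed

lemma commutes_conjugate_iff:
  assumes "h \<in> carrier G" "a \<in> carrier G" "b \<in> carrier G"
  shows "commutes (conjugate h a) (conjugate h b) \<longleftrightarrow> commutes a b"
proof
  assume "commutes (conjugate h a) (conjugate h b)"
  then have "conjugate h (a \<otimes> b) = conjugate h (b \<otimes> a)"
    using assms by (simp add: commutes_def conjugate_mult)
  then show "commutes a b"
    unfolding commutes_def using assms by (metis conjugate_inv_cancel(1) m_closed)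
qed (use assms in \<open>simp add: commutes_def flip: conjugate_mult\<close>)

lemma conjugate_Z: "h \<in> carrier G \<Longrightarrow> z \<in> Z \<Longrightarrow> conjugate h z = z"
  using conjugate_eq_self_iff Z_central Z_carrier unfolding commutes_def by metis

lemma conjugate_noncentral [simp]: "h \<in> carrier G \<Longrightarrow> a \<in> noncentral \<Longrightarrow> conjugate h a \<in> noncentral"
  by (metis DiffD1 DiffD2 DiffI conjugate_Z conjugate_closed conjugate_inv_cancel(1) inv_closed)

lemma commutes_refl [simp]: "commutes a a" by (simp add: commutes_def)

lemma commutes_sym: "commutes a b \<Longrightarrow> commutes b a" by (simp add: commutes_def)

lemma commutes_trans:
  "\<lbrakk>a \<in> noncentral; b \<in> noncentral; c \<in> noncentral; commutes a b; commutes b c\<rbrakk> \<Longrightarrow> commutes a c"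
  using comm_trans unfolding commutes_def by blast

lemma torus_subset: "torus a \<subseteq> noncentral" unfolding torus_def by blast

lemma finite_sets [simp]: "finite (torus a)" "finite (torus_normalizer a)" "finite (torus_class a)" "finite (centralizer a)" "finite Z"
  using finite_carrier finite_subset[OF subgroup.subset[OF Z_subgroup]]
  by (auto simp: torus_def torus_normalizer_def torus_class_def centralizer_def)

section \<open>Sizes of tori, their normalizers and their classes\<close>

lemma centralizer_eq:
  assumes "a \<in> carrier G" shows "centralizer a = torus a \<union> Z"
  using assms Z_carrier Z_central by (auto simp: centralizer_def torus_def commutes_def)

lemma card_centralizer:
  assumes "a \<in> carrier G" shows "card (centralizer a) = card (torus a) + 2"
  unfolding centralizer_eq[OF assms] using torus_subset card_Z by (subst card_Un_disjoint) auto

text \<open>Any single element of the torus decides whether \<open>k\<close> normalizes it: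
  \<open>conjugate k b\<close> commutes with \<open>conjugate k a\<close>, so by transitivity both
  or neither commute with \<open>a\<close>.\<close>

lemma conjugate_torus_iff:
  assumes a: "a \<in> noncentral" and b: "b \<in> torus a" and k: "k \<in> carrier G"
  shows "conjugate k b \<in> torus a \<longleftrightarrow> k \<in> torus_normalizer a"
proof -
  have b': "b \<in> noncentral" "commutes b a" using b by (auto simp: torus_def)
  then have "commutes (conjugate k b) (conjugate k a)"
    using commutes_conjugate_iff[of k b a] a k by blast
  moreover have "conjugate k b \<in> noncentral" "conjugate k a \<in> noncentral"
    using conjugate_noncentral a b' k by blast+
  ultimately have "commutes (conjugate k b) a \<longleftrightarrow> commutes (conjugate k a) a"
    using commutes_trans[of "conjugate k b" "conjugate k a" a] commutes_trans[of "conjugate k a" "conjugate k b" a] commutes_sym a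
    by blast
  then show ?thesis
    using \<open>conjugate k b \<in> noncentral\<close> k by (simp add: torus_def torus_normalizer_def)
qed

lemma inv_torus_normalizer_iff:
  assumes a: "a \<in> carrier G" and k: "k \<in> carrier G"
  shows "inv k \<in> torus_normalizer a \<longleftrightarrow> k \<in> torus_normalizer a"
proof -
  have "commutes (conjugate (inv k) a) a \<longleftrightarrow> commutes a (conjugate k a)"
    using commutes_conjugate_iff[of k "conjugate (inv k) a" a] a k by simp
  then show ?thesis
    using k commutes_sym by (auto simp: torus_normalizer_def)
qed

text \<open>The pairs with the same image as \<open>(h0, b0)\<close> are
  \<open>(h0 \<otimes> k, conjugate (inv k) b0)\<close>, one for each \<open>k\<close> in the
  normalizer.\<close>

lemma card_fibre:
  assumes a: "a \<in> noncentral" and h0: "h0 \<in> carrier G" and b0: "b0 \<in> torus a"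
  shows "card {z \<in> carrier G \<times> torus a. (\<lambda>(h, b). conjugate h b) z = conjugate h0 b0} = card (torus_normalizer a)"
proof -
  have b0c: "b0 \<in> carrier G" using b0 by (simp add: torus_def)
  have Nc: "k \<in> carrier G" if "k \<in> torus_normalizer a" for k using that by (simp add: torus_normalizer_def)
  have "bij_betw (\<lambda>k. (h0 \<otimes> k, conjugate (inv k) b0)) (torus_normalizer a)
    {z \<in> carrier G \<times> torus a. (\<lambda>(h, b). conjugate h b) z = conjugate h0 b0}"
  proof (rule bij_betwI[where g = "\<lambda>(h, b). inv h0 \<otimes> h"])
    show "(\<lambda>k. (h0 \<otimes> k, conjugate (inv k) b0)) \<in> torus_normalizer a \<rightarrow>
      {z \<in> carrier G \<times> torus a. (\<lambda>(h, b). conjugate h b) z = conjugate h0 b0}"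
      using Nc h0 b0c conjugate_torus_iff[OF a b0] inv_torus_normalizer_iff a
      by (auto simp: conjugate_conjugate[symmetric])
    show "(\<lambda>(h, b). inv h0 \<otimes> h) \<in>
      {z \<in> carrier G \<times> torus a. (\<lambda>(h, b). conjugate h b) z = conjugate h0 b0} \<rightarrow> torus_normalizer a"
    proof clarsimp
      fix h b assume h: "h \<in> carrier G" and b: "b \<in> torus a" and eq: "conjugate h b = conjugate h0 b0"
      have bc: "b \<in> carrier G" using b by (simp add: torus_def)
      have "conjugate (inv h0 \<otimes> h) b = b0"
        using h h0 bc b0c by (simp add: eq flip: conjugate_conjugate)
      then show "inv h0 \<otimes> h \<in> torus_normalizer a"
        using conjugate_torus_iff[OF a b, of "inv h0 \<otimes> h"] b0 h h0 by simp
    qed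
    show "(\<lambda>(h, b). inv h0 \<otimes> h) (h0 \<otimes> k, conjugate (inv k) b0) = k" if "k \<in> torus_normalizer a" for k
      using Nc[OF that] h0 by (simp add: m_assoc[symmetric])
    show "(h0 \<otimes> ((\<lambda>(h, b). inv h0 \<otimes> h) z), conjugate (inv ((\<lambda>(h, b). inv h0 \<otimes> h) z)) b0) = z"
      if "z \<in> {z \<in> carrier G \<times> torus a. (\<lambda>(h, b). conjugate h b) z = conjugate h0 b0}" for z
    proof -
      obtain h b where z: "z = (h, b)" "h \<in> carrier G" "b \<in> torus a" "conjugate h b = conjugate h0 b0"
        using \<open>z \<in> _\<close> by auto
      have bc: "b \<in> carrier G" using z by (simp add: torus_def)
      have "conjugate (inv (inv h0 \<otimes> h)) b0 = conjugate (inv h) (conjugate h0 b0)"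
        using z h0 b0c by (simp add: inv_mult_group conjugate_conjugate)
      also have "\<dots> = b" using z bc by (simp flip: z(4))
      finally show ?thesis using z h0 by (simp add: m_assoc[symmetric])
    qed
  qed
  then show ?thesis by (simp add: bij_betw_same_card)
qed

lemma card_torus_class:
  assumes a: "a \<in> noncentral"
  shows "card (torus_class a) * card (torus_normalizer a) = card (carrier G) * card (torus a)"
proof -
  define S where "S = carrier G \<times> torus a"
  define f where "f = (\<lambda>(h, b). conjugate h b)"
  have "finite S" unfolding S_def using finite_carrier by simp
  then have "card S = (\<Sum>c \<in> f ` S. card {z \<in> S. f z = c})"
    using sum.image_gen[of S "\<lambda>_. 1::nat" f] by simp
  also have "\<dots> = (\<Sum>c \<in> f ` S. card (torus_normalizer a))"
    using card_fibre[OF a] by (intro sum.cong) (auto simp: S_def f_def)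
  finally show ?thesis
    by (simp add: torus_class_def S_def f_def card_cartesian_product)
qed

lemma centralizer_subgroup:
  assumes "a \<in> carrier G" shows "subgroup (centralizer a) G"
proof (rule subgroupI)
  have centralizer: "b \<in> centralizer a \<longleftrightarrow> b \<in> carrier G \<and> conjugate b a = a" for b
    using assms conjugate_eq_self_iff by (auto simp: centralizer_def)
  show "inv b \<in> centralizer a" if "b \<in> centralizer a" for b
    using that assms conjugate_inv_cancel(1)[of b a] by (simp add: centralizer)
  show "b \<otimes> c \<in> centralizer a" if "b \<in> centralizer a" "c \<in> centralizer a" for b c
    using that assms conjugate_conjugate[of b c a] by (simp add: centralizer)
  show "centralizer a \<noteq> {}" using assms by (auto simp: centralizer_def)
qed (auto simp: centralizer_def)

lemma even_card_centralizer:
  assumes "a \<in> carrier G" shows "even (card (centralizer a))"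
proof -
  interpret C: group "G\<lparr>carrier := centralizer a\<rparr>"
    by (rule subgroup_imp_group[OF centralizer_subgroup[OF assms]])
  have "subgroup Z (G\<lparr>carrier := centralizer a\<rparr>)"
    using centralizer_eq[OF assms] centralizer_subgroup[OF assms] Z_subgroup
    by (intro subgroup_incl) auto
  from C.lagrange[OF this] have "card (rcosets\<^bsub>G\<lparr>carrier := centralizer a\<rparr>\<^esub> Z) * 2 = card (centralizer a)"
    by (simp add: card_Z Coset.order_def)
  then show ?thesis by presburger
qed

text \<open>The centralizer contains \<open>Z\<close> and \<open>a\<close>, hence at least 3
  elements, and its order is even.\<close>

lemma card_centralizer_ge_4:
  assumes "a \<in> noncentral" shows "card (centralizer a) \<ge> 4"
proof -
  have "a \<in> torus a" using assms by (simp add: torus_def)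
  then have "card (torus a) > 0" by (auto simp: card_gt_0_iff)
  moreover have "even (card (centralizer a))" using assms even_card_centralizer by simp
  ultimately show ?thesis using assms card_centralizer[of a] by (auto elim!: evenE)
qed

text \<open>A normalizing element sends \<open>a\<close> to \<open>a\<close> or to
  \<open>inv a\<close>. The elements of the second kind form the set \<open>I\<close>, which is
  empty or a coset of the centralizer, and \<open>a\<close> differs from \<open>inv a\<close>
  because only elements of \<open>Z\<close> are involutions or 1.\<close>

lemma card_torus_normalizer:
  assumes a: "a \<in> noncentral"
  shows "torus_normalizer a = centralizer a \<or> card (torus_normalizer a) = 2 * card (centralizer a)"
proof -
  define I where "I = {h \<in> carrier G. conjugate h a = inv a}"
  have ac: "a \<in> carrier G" using a by simp
  have normalizer_eq: "torus_normalizer a = centralizer a \<union> I"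
  proof -
    have "conjugate h a \<in> {a, inv a}" if "h \<in> carrier G" "commutes (conjugate h a) a" for h
      using conj_commuting[OF a that(1)] that(2) unfolding commutes_def conjugate_def by blast
    moreover have "commutes (conjugate h a) a" if "conjugate h a = a \<or> conjugate h a = inv a" for h
      using that ac by (auto simp: commutes_def)
    moreover have "conjugate h a = a" if "h \<in> carrier G" "commutes h a" for h
      using that ac conjugate_eq_self_iff by blast
    ultimately show ?thesis
      using ac conjugate_eq_self_iff by (auto simp: torus_normalizer_def centralizer_def I_def)
  qed
  have disj: "centralizer a \<inter> I = {}"
  proof -
    have "a \<noteq> inv a"
      using a involution[of a] by (metis DiffD1 DiffD2 r_inv)
    then show ?thesis
      using ac by (auto simp: centralizer_def I_def simp flip: conjugate_eq_self_iff)
  qed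
  show ?thesis
  proof (cases "I = {}")
    case True
    then show ?thesis using normalizer_eq by simp
  next
    case False
    then obtain h0 where h0: "h0 \<in> carrier G" "conjugate h0 a = inv a" by (auto simp: I_def)
    have h0': "conjugate (inv h0) (inv a) = a"
      using h0 ac by (metis conjugate_inv_cancel(1))
    have "bij_betw (\<lambda>c. h0 \<otimes> c) (centralizer a) I"
    proof (rule bij_betwI[where g = "\<lambda>h. inv h0 \<otimes> h"])
      show "(\<lambda>c. h0 \<otimes> c) \<in> centralizer a \<rightarrow> I"
        using h0 ac by (auto simp: centralizer_def I_def simp flip: conjugate_conjugate conjugate_eq_self_iff)
      show "(\<lambda>h. inv h0 \<otimes> h) \<in> I \<rightarrow> centralizer a"
        using h0 h0' ac by (auto simp: centralizer_def I_def conjugate_conjugate[symmetric] simp flip: conjugate_eq_self_iff)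
    qed (use h0 in \<open>auto simp: centralizer_def I_def m_assoc[symmetric]\<close>)
    then have "card I = card (centralizer a)" by (simp add: bij_betw_same_card)
    moreover have "finite I" using finite_carrier by (simp add: I_def)
    ultimately show ?thesis
      unfolding normalizer_eq using disj by (simp add: card_Un_disjoint)
  qed
qed

section \<open>The partition into torus classes and its densities\<close>

lemma mem_torus_class: "a \<in> noncentral \<Longrightarrow> a \<in> torus_class a"
  unfolding torus_class_def torus_def by (auto intro!: image_eqI[where x = "(\<one>, a)"])

lemma torus_class_subset: "torus_class a \<subseteq> noncentral"
  unfolding torus_class_def torus_def using conjugate_noncentral by fastforce

lemma torus_class_iff:
  assumes "a \<in> carrier G"
  shows "b \<in> torus_class a \<longleftrightarrow> b \<in> noncentral \<and> (\<exists>h \<in> carrier G. commutes b (conjugate h a))"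
proof
  assume "b \<in> torus_class a"
  then obtain h c where h: "h \<in> carrier G" "c \<in> noncentral" "commutes c a" "b = conjugate h c"
    unfolding torus_class_def torus_def by auto
  then show "b \<in> noncentral \<and> (\<exists>h \<in> carrier G. commutes b (conjugate h a))"
    using assms commutes_conjugate_iff[of h c a] conjugate_noncentral[of h c] by blast
next
  assume "b \<in> noncentral \<and> (\<exists>h \<in> carrier G. commutes b (conjugate h a))"
  then obtain h where b: "b \<in> noncentral" and h: "h \<in> carrier G" "commutes b (conjugate h a)" by blast
  have "commutes (conjugate (inv h) b) a"
    using commutes_conjugate_iff[of h "conjugate (inv h) b" a] h b assms by simp
  moreover have "conjugate (inv h) b \<in> noncentral" using h b by (intro conjugate_noncentral) auto
  ultimately have "conjugate (inv h) b \<in> torus a" by (simp add: torus_def)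
  then show "b \<in> torus_class a"
    unfolding torus_class_def using h b by (auto intro!: image_eqI[where x = "(h, conjugate (inv h) b)"])
qed

text \<open>A common element commutes with a conjugate of \<open>a\<close> and with one of
  \<open>b\<close>; by transitivity these conjugates commute, which puts \<open>b\<close> into the
  class of \<open>a\<close>.\<close>

lemma torus_classes_disjoint:
  assumes a: "a \<in> noncentral" and b: "b \<in> noncentral" and nb: "b \<notin> torus_class a"
  shows "torus_class a \<inter> torus_class b = {}"
proof (rule ccontr)
  assume "torus_class a \<inter> torus_class b \<noteq> {}"
  then obtain c where "c \<in> torus_class a" "c \<in> torus_class b" by auto
  then obtain h k where c: "c \<in> noncentral" and h: "h \<in> carrier G" "commutes c (conjugate h a)"
    and k: "k \<in> carrier G" "commutes c (conjugate k b)"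
    using torus_class_iff[of a c] torus_class_iff[of b c] a b by auto
  have "commutes (conjugate k b) (conjugate h a)"
    using commutes_trans[of "conjugate k b" c "conjugate h a"] commutes_sym c h k a b conjugate_noncentral by blast
  then have "commutes b (conjugate (inv k) (conjugate h a))"
    using commutes_conjugate_iff[of k b "conjugate (inv k) (conjugate h a)"] a b h k by simp
  then have "b \<in> torus_class a"
    using a b h k by (auto simp: torus_class_iff conjugate_conjugate intro!: bexI[where x = "inv k \<otimes> h"])
  with nb show False ..
qed

text \<open>The share of the group covered by a class. Over a full set of disjoint classes the
  shares add up to \<open>1 - 2 / card (carrier G)\<close>, the share of the elements outside
  \<open>Z\<close>.\<close>

definition density :: "'a \<Rightarrow> real" where "density a = card (torus_class a) / card (carrier G)"

lemma carrier_card_pos: "card (carrier G) > 0"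
  using finite_carrier one_closed card_gt_0_iff by blast

lemma density_eq:
  assumes a: "a \<in> noncentral"
  shows "torus_normalizer a = centralizer a \<and> density a = 1 - 2 / card (centralizer a) \<or>
    card (torus_normalizer a) = 2 * card (centralizer a) \<and> density a = 1 / 2 - 1 / card (centralizer a)"
proof -
  define m where "m = real (card (centralizer a))"
  have m: "m \<ge> 4" using card_centralizer_ge_4[OF a] by (simp add: m_def)
  have cardT: "real (card (torus a)) = m - 2" using card_centralizer[of a] a by (simp add: m_def)
  have n: "real (card (carrier G)) > 0" using carrier_card_pos by simp
  have eq: "real (card (torus_class a)) * real (card (torus_normalizer a)) = real (card (carrier G)) * (m - 2)"
    using arg_cong[OF card_torus_class[OF a], of real] cardT by simp
  show ?thesis
  proof (cases "torus_normalizer a = centralizer a")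
    case True
    then show ?thesis
      using eq m n by (simp add: density_def flip: m_def) (simp add: field_simps)
  next
    case False
    then have "card (torus_normalizer a) = 2 * card (centralizer a)" using card_torus_normalizer[OF a] by blast
    then show ?thesis
      using eq m n by (simp add: density_def flip: m_def) (simp add: field_simps)
  qed
qed

text \<open>Centralizers have even order, at least 4. Order 4 gives 1/2 or 1/4, according to the
  index in the normalizer; order 6 or more gives at least 2/3, or a value from 1/3 to 1/2. The gaps
  between these values drive the counting argument.\<close>

lemma density_cases:
  assumes a: "a \<in> noncentral"
  shows "density a = 1 / 4 \<or> 1 / 3 \<le> density a \<and> density a \<le> 1 / 2 \<or> density a \<ge> 2 / 3"
proof (cases "card (centralizer a) = 4")
  case True
  then show ?thesis using density_eq[OF a] by auto
next
  case False
  then have "card (centralizer a) \<ge> 6"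
    using even_card_centralizer[of a] card_centralizer_ge_4[OF a] a by (auto elim!: evenE)
  then have "1 / real (card (centralizer a)) \<le> 1 / 6" "0 < 1 / real (card (centralizer a))"
    by (auto simp: field_simps)
  moreover have "2 / real (card (centralizer a)) = 2 * (1 / real (card (centralizer a)))" by simp
  ultimately show ?thesis using density_eq[OF a] by linarith
qed

lemma density_sum:
  assumes "finite I" "\<And>a b. a \<in> I \<Longrightarrow> b \<in> I \<Longrightarrow> a \<noteq> b \<Longrightarrow> torus_class a \<inter> torus_class b = {}"
  shows "(\<Sum>a\<in>I. density a) = card (\<Union>a\<in>I. torus_class a) / card (carrier G)"
proof -
  have "card (\<Union>a\<in>I. torus_class a) = (\<Sum>a\<in>I. card (torus_class a))"
    using assms by (intro card_UN_disjoint) auto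
  then show ?thesis
    unfolding density_def by (simp add: sum_divide_distrib)
qed

lemma density_noncentral: "card noncentral / card (carrier G) = 1 - 2 / card (carrier G)"
proof -
  have "card noncentral = card (carrier G) - 2"
    using card_Diff_subset[of Z "carrier G"] subgroup.subset[OF Z_subgroup] card_Z by simp
  moreover have "card (carrier G) \<ge> 2"
    using card_mono[OF finite_carrier subgroup.subset[OF Z_subgroup]] card_Z by simp
  ultimately have "real (card noncentral) = real (card (carrier G)) - 2" by simp
  then show ?thesis using carrier_card_pos by (simp add: field_simps)
qed

text \<open>Classes that do not yet fill the complement of \<open>Z\<close> leave an element
  outside, whose class is disjoint from them; the enlarged family still fits into the
  complement.\<close>

lemma obtain_new_class:
  assumes "finite I" "I \<subseteq> noncentral"
    and "\<And>a b. a \<in> I \<Longrightarrow> b \<in> I \<Longrightarrow> a \<noteq> b \<Longrightarrow> torus_class a \<inter> torus_class b = {}"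
    and "(\<Sum>a\<in>I. density a) \<noteq> 1 - 2 / card (carrier G)"
  obtains b where "b \<in> noncentral" "b \<notin> I"
    "\<And>a c. a \<in> insert b I \<Longrightarrow> c \<in> insert b I \<Longrightarrow> a \<noteq> c \<Longrightarrow> torus_class a \<inter> torus_class c = {}"
    "density b + (\<Sum>a\<in>I. density a) \<le> 1 - 2 / card (carrier G)"
proof -
  have "noncentral \<noteq> (\<Union>a\<in>I. torus_class a)"
    using density_sum[OF assms(1,3)] density_noncentral assms(4) by metis
  then obtain b where b: "b \<in> noncentral" "\<And>a. a \<in> I \<Longrightarrow> b \<notin> torus_class a"
    using torus_class_subset by blast
  have notin: "b \<notin> I" using b mem_torus_class by blast
  have disj: "torus_class a \<inter> torus_class c = {}" if "a \<in> insert b I" "c \<in> insert b I" "a \<noteq> c" for a c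
    using that assms(2,3) b torus_classes_disjoint by blast
  have "(\<Sum>a\<in>insert b I. density a) = card (\<Union>a\<in>insert b I. torus_class a) / card (carrier G)"
    using assms(1) disj by (intro density_sum) auto
  also have "\<dots> \<le> card noncentral / card (carrier G)"
    using torus_class_subset finite_carrier by (intro divide_right_mono of_nat_mono card_mono) auto
  finally have "(\<Sum>a\<in>insert b I. density a) \<le> 1 - 2 / card (carrier G)"
    unfolding density_noncentral .
  then have "density b + (\<Sum>a\<in>I. density a) \<le> 1 - 2 / card (carrier G)"
    using assms(1) notin by simp
  with that[of b] b notin disj show thesis by blast
qed

text \<open>If \<open>x\<close> and \<open>y\<close> do not commute, the normalizer of the torus of
  \<open>x\<close> is a proper subset of the group, so the class of \<open>x\<close> leaves room for
  others. If the normalizer is the centralizer, the density of \<open>x\<close> is at least 5/6, and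
  a further class needs 1/4. If the index is 2, the remaining share cannot be filled
  exactly.\<close>

theorem commute_of_large_centralizer:
  assumes x: "x \<in> noncentral" and large: "card (centralizer x) \<ge> 12"
    and y: "y \<in> carrier G" "y \<otimes> y \<notin> Z"
  shows "x \<otimes> y = y \<otimes> x"
proof (rule ccontr)
  assume "x \<otimes> y \<noteq> y \<otimes> x"
  then have ncom: "\<not> commutes y x" by (auto simp: commutes_def)
  define n where "n = real (card (carrier G))"
  define m where "m = real (card (centralizer x))"
  have m: "m \<ge> 12" using large by (simp add: m_def)
  have n: "n > 0" using carrier_card_pos by (simp add: n_def)
  have y_nc: "y \<in> noncentral"
    using y subgroup.m_closed[OF Z_subgroup] by blast
  have d: "density b \<ge> 1 / 4" if "b \<in> noncentral" for b
    using density_cases[OF that] by auto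
  have ysq: "y \<otimes> y \<in> noncentral" using y by simp
  \<comment> \<open>Otherwise \<open>y\<close> would invert \<open>x\<close>, so
    \<open>y \<otimes> y\<close> would commute with \<open>x\<close>; as
    \<open>y \<otimes> y\<close> lies outside \<open>Z\<close>, transitivity would make
    \<open>y\<close> commute with \<open>x\<close>.\<close>
  have yN: "y \<notin> torus_normalizer x"
  proof
    assume "y \<in> torus_normalizer x"
    then have "commutes (conjugate y x) x" by (simp add: torus_normalizer_def)
    then have "conjugate y x \<in> {x, inv x}"
      using conj_commuting[OF x y(1)] unfolding commutes_def conjugate_def by blast
    then have "conjugate y x = inv x"
      using ncom x y conjugate_eq_self_iff by auto
    moreover from this have "conjugate y (inv x) = x"
      using x y by (metis DiffD1 conjugate_def inv_closed inv_inv inv_mult_group m_assoc m_closed)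
    ultimately have "conjugate (y \<otimes> y) x = x"
      using x y by (simp flip: conjugate_conjugate)
    then have "commutes (y \<otimes> y) x" using x y by (simp add: conjugate_eq_self_iff)
    moreover have "commutes y (y \<otimes> y)" using y by (simp add: commutes_def m_assoc)
    ultimately show False using commutes_trans[OF y_nc ysq x] ncom by blast
  qed
  have Nn: "card (torus_normalizer x) < card (carrier G)"
    using yN y finite_carrier by (intro psubset_card_mono) (auto simp: torus_normalizer_def)
  consider "torus_normalizer x = centralizer x" "density x = 1 - 2 / m"
    | "card (torus_normalizer x) = 2 * card (centralizer x)" "density x = 1 / 2 - 1 / m"
    using density_eq[OF x] unfolding m_def by blast
  then show False
  proof cases
    case 1
    then have "m < n" using Nn by (simp add: m_def n_def)
    then have "2 / n < 2 / m" using m by (simp add: field_simps)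
    then have "density x \<noteq> 1 - 2 / n" using 1(2) by linarith
    then have ne: "(\<Sum>a\<in>{x}. density a) \<noteq> 1 - 2 / card (carrier G)" by (simp add: n_def)
    obtain b where "b \<in> noncentral" "density b + (\<Sum>a\<in>{x}. density a) \<le> 1 - 2 / card (carrier G)"
      by (rule obtain_new_class[OF _ _ _ ne]) (use x in auto)
    then have "b \<in> noncentral" "density b + density x \<le> 1 - 2 / n"
      by (simp_all add: n_def)
    moreover have "2 / m \<le> 1 / 6" using m by (simp add: field_simps)
    moreover have "2 / n > 0" using n by simp
    ultimately show False using d[of b] 1(2) by linarith
  next
    case 2
    then have "2 * m < n" using Nn by (simp add: m_def n_def)
    then have mn: "2 / n < 1 / m" using m by (simp add: field_simps)
    \<comment> \<open>The bound 12 keeps the share \<open>1 / 2 + 1 / m - 2 / n\<close> of the other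
      classes below 7/12, which is 1/4 + 1/3.\<close>
    have m': "1 / m \<le> 1 / 12" using m by (simp add: field_simps)
    have n': "2 / n > 0" using n by simp
    \<comment> \<open>The classes other than that of \<open>x\<close> have total density in the open interval from 1/2 to 7/12,
      which is not a sum of densities.\<close>
    have ne: "(\<Sum>a\<in>{x}. density a) \<noteq> 1 - 2 / card (carrier G)"
      using 2(2) mn m' by (simp add: n_def)
    obtain b where b: "b \<in> noncentral" "b \<notin> {x}"
      "\<And>a c. a \<in> {b, x} \<Longrightarrow> c \<in> {b, x} \<Longrightarrow> a \<noteq> c \<Longrightarrow> torus_class a \<inter> torus_class c = {}"
      "density b + (\<Sum>a\<in>{x}. density a) \<le> 1 - 2 / card (carrier G)"
      by (rule obtain_new_class[OF _ _ _ ne]) (use x in auto)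
    then have bx: "density b + density x \<le> 1 - 2 / n" by (simp add: n_def)
    \<comment> \<open>A density of 2/3 would already exceed 7/12.\<close>
    have b12: "density b \<le> 1 / 2"
      using density_cases[OF b(1)] bx 2(2) m' n' by linarith
    have ne: "(\<Sum>a\<in>{b, x}. density a) \<noteq> 1 - 2 / card (carrier G)"
      using b12 b(2) 2(2) mn by (simp add: n_def)
    obtain c where c: "c \<in> noncentral" "c \<notin> {b, x}"
      "\<And>a d. a \<in> {c, b, x} \<Longrightarrow> d \<in> {c, b, x} \<Longrightarrow> a \<noteq> d \<Longrightarrow> torus_class a \<inter> torus_class d = {}"
      "density c + (\<Sum>a\<in>{b, x}. density a) \<le> 1 - 2 / card (carrier G)"
      by (rule obtain_new_class[OF _ _ b(3) ne]) (use x b(1) in auto)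
    then have cbx: "density c + (density b + density x) \<le> 1 - 2 / n"
      using b(2) by (simp add: n_def)
    \<comment> \<open>If either density were 1/3 or more, the two would add up to at least
      7/12.\<close>
    have bc4: "density b = 1 / 4" "density c = 1 / 4"
      using density_cases[OF b(1)] density_cases[OF c(1)] cbx 2(2) m' n' by linarith+
    have ne: "(\<Sum>a\<in>{c, b, x}. density a) \<noteq> 1 - 2 / card (carrier G)"
      using b(2) c(2) bc4 2(2) mn by (simp add: n_def)
    \<comment> \<open>Two quarters fall short, while a third class besides that of \<open>x\<close>
      makes at least 3/4.\<close>
    obtain e where "e \<in> noncentral"
      "density e + (\<Sum>a\<in>{c, b, x}. density a) \<le> 1 - 2 / card (carrier G)"
      by (rule obtain_new_class[OF _ _ c(3) ne]) (use x b(1) c(1) in auto)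
    then have "e \<in> noncentral" "density e + (density c + (density b + density x)) \<le> 1 - 2 / n"
      using b(2) c(2) by (simp_all add: n_def)
    then show False
      using d[of e] bc4 2(2) m' n' by linarith
  qed
qed

end


section \<open>Matrices of size 2 modulo a prime\<close>

text \<open>The reduction inside the definition admits arbitrary integers as entries, so that matrix
  identities become divisibilities by \<open>p\<close>.\<close>

definition mat2 :: "nat \<Rightarrow> int \<Rightarrow> int \<Rightarrow> int \<Rightarrow> int \<Rightarrow> int mat"
  where "mat2 p a b c d = mat_mod p (mat 2 2 (\<lambda>(i, j). if i = 0 then if j = 0 then a else b
    else if j = 0 then c else d))"

lemma mat2_carrier [simp]: "mat2 p a b c d \<in> carrier_mat 2 2"
  by (simp add: mat2_def)

lemma mat2_dim [simp]: "dim_row (mat2 p a b c d) = 2" "dim_col (mat2 p a b c d) = 2"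
  by (simp_all add: mat2_def)

lemma mat2_index [simp]:
  "mat2 p a b c d $$ (0, 0) = a mod int p" "mat2 p a b c d $$ (0, Suc 0) = b mod int p"
  "mat2 p a b c d $$ (Suc 0, 0) = c mod int p" "mat2 p a b c d $$ (Suc 0, Suc 0) = d mod int p"
  by (simp_all add: mat2_def)

lemma det_mat_2:
  assumes "A \<in> carrier_mat 2 2"
  shows "det A = A $$ (0, 0) * A $$ (Suc 0, Suc 0) - A $$ (0, Suc 0) * A $$ (Suc 0, 0)"
proof -
  have "det (mat_delete A 0 j) = A $$ (Suc 0, 1 - j)" if "j < 2" for j
    using assms that by (subst det_single) (auto simp: mat_delete_def less_2_cases_iff)
  then show ?thesis
    using laplace_expansion_row[OF assms, of 0]
    by (simp add: numeral_2_eq_2 cofactor_def)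
qed

lemma mat_2_eq_iff:
  assumes "A \<in> carrier_mat 2 2" "B \<in> carrier_mat 2 2"
  shows "A = B \<longleftrightarrow> A $$ (0, 0) = B $$ (0, 0) \<and> A $$ (0, Suc 0) = B $$ (0, Suc 0) \<and>
    A $$ (Suc 0, 0) = B $$ (Suc 0, 0) \<and> A $$ (Suc 0, Suc 0) = B $$ (Suc 0, Suc 0)"
  using assms by (auto intro!: eq_matI simp: less_2_cases_iff)

lemma mat2_eq_iff:
  "mat2 p a b c d = mat2 p a' b' c' d' \<longleftrightarrow>
    [a = a'] (mod int p) \<and> [b = b'] (mod int p) \<and> [c = c'] (mod int p) \<and> [d = d'] (mod int p)"
  by (subst mat_2_eq_iff) (auto simp: cong_def)

lemma det_mat2: "[det (mat2 p a b c d) = a * d - b * c] (mod int p)"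
proof -
  have "det (mat2 p a b c d) = (a mod int p) * (d mod int p) - (b mod int p) * (c mod int p)"
    by (subst det_mat_2) auto
  then show ?thesis
    by (simp add: cong_def mod_diff_eq mod_mult_eq) (metis mod_diff_eq mod_mult_eq)
qed

lemma mat2_mem_SL:
  assumes "p > 0"
  shows "mat2 p a b c d \<in> carrier (SL 2 p) \<longleftrightarrow> [a * d - b * c = 1] (mod int p)"
proof -
  have "mat2 p a b c d $$ (i, j) \<in> {0..int p - 1}" if "i < 2" "j < 2" for i j
    using that assms by (auto simp: less_2_cases_iff)
  then have "mat2 p a b c d \<in> carrier (SL 2 p) \<longleftrightarrow> [det (mat2 p a b c d) = 1] (mod int p)"
    by (simp add: carrier_SL)
  then show ?thesis
    using det_mat2[of p a b c d] by (meson cong_sym cong_trans)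
qed

lemma SL2_cases:
  assumes "p > 0" "A \<in> carrier (SL 2 p)"
  obtains a b c d where "A = mat2 p a b c d" "[a * d - b * c = 1] (mod int p)"
proof -
  have A: "A \<in> carrier_mat 2 2" "mat_mod p A = A"
    using assms by (auto simp: carrier_SL mat_mod_id)
  have "A = mat 2 2 (\<lambda>(i, j). if i = 0 then if j = 0 then A $$ (0, 0) else A $$ (0, Suc 0)
    else if j = 0 then A $$ (Suc 0, 0) else A $$ (Suc 0, Suc 0))"
    using A by (subst mat_2_eq_iff) auto
  then have "A = mat2 p (A $$ (0, 0)) (A $$ (0, Suc 0)) (A $$ (Suc 0, 0)) (A $$ (Suc 0, Suc 0))"
    using A(2) unfolding mat2_def by simp
  with that show thesis using assms mat2_mem_SL by metis
qed

lemma mat2_mult [simp]: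
  "mat2 p a b c d \<otimes>\<^bsub>SL 2 p\<^esub> mat2 p a' b' c' d' =
    mat2 p (a * a' + b * c') (a * b' + b * d') (c * a' + d * c') (c * b' + d * d')"
proof -
  have "(x mod m * (y mod m) + u mod m * (v mod m)) mod m = (x * y + u * v) mod m" for x y u v m :: int
    by (metis mod_add_eq mod_mult_eq)
  then show ?thesis
    unfolding SL_def
    by (subst mat_2_eq_iff) (auto simp: scalar_prod_def numeral_2_eq_2)
qed

lemma one_SL2: "p > 1 \<Longrightarrow> \<one>\<^bsub>SL 2 p\<^esub> = mat2 p 1 0 0 1"
  unfolding SL_def by (subst mat_2_eq_iff) (auto simp: one_mat_def)

lemma inv_mat2:
  assumes "p > 1" "[a * d - b * c = 1] (mod int p)"
  shows "inv\<^bsub>SL 2 p\<^esub> (mat2 p a b c d) = mat2 p d (- b) (- c) a"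
proof (rule group.inv_equality[OF group_SL[OF assms(1)]])
  show "mat2 p d (- b) (- c) a \<otimes>\<^bsub>SL 2 p\<^esub> mat2 p a b c d = \<one>\<^bsub>SL 2 p\<^esub>"
    using assms by (simp add: one_SL2 mat2_eq_iff mult.commute)
qed (use assms in \<open>auto simp: mat2_mem_SL mult.commute\<close>)

section \<open>The group SL(2, p) for an odd prime p\<close>

locale odd_prime =
  fixes p :: nat
  assumes prime_p: "prime p" and p_gt_2: "p > 2"
begin

abbreviation P :: int where "P \<equiv> int p"

abbreviation G :: "int mat monoid" where "G \<equiv> SL 2 p"

abbreviation mk :: "int \<Rightarrow> int \<Rightarrow> int \<Rightarrow> int \<Rightarrow> int mat" where "mk \<equiv> mat2 p"

definition Z :: "int mat set" where "Z = {mk 1 0 0 1, mk (-1) 0 0 (-1)}"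

lemma prime_P: "prime P" using prime_p by simp

sublocale G: group G using group_SL p_gt_2 by simp

lemma p_gt_1: "p > 1" and p_gt_0: "p > 0" using p_gt_2 by auto

lemmas mem_G = mat2_mem_SL[OF p_gt_0]
lemmas one_G = one_SL2[OF p_gt_1]
lemmas inv_mk = inv_mat2[OF p_gt_1]
lemmas G_cases = SL2_cases[OF p_gt_0]

lemma mk_eq_iff:
  "mk a b c d = mk a' b' c' d' \<longleftrightarrow> P dvd a - a' \<and> P dvd b - b' \<and> P dvd c - c' \<and> P dvd d - d'"
  by (simp add: mat2_eq_iff cong_iff_dvd_diff)

lemma dvd_mult_iff: "P dvd a * b \<longleftrightarrow> P dvd a \<or> P dvd b"
  using prime_P by (rule prime_dvd_mult_iff)

lemma not_dvd_2: "\<not> P dvd 2"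
  using p_gt_2 zdvd_imp_le by force

lemma dvd_2_mult_iff [simp]: "P dvd 2 * a \<longleftrightarrow> P dvd a"
  using not_dvd_2 by (simp add: dvd_mult_iff)

lemma inverse_mod:
  assumes "\<not> P dvd a" obtains i where "P dvd a * i - 1"
proof -
  have "coprime a P"
    using assms prime_P prime_imp_coprime coprime_commute by blast
  then obtain i where "[a * i = 1] (mod P)" using cong_solve_coprime_int by blast
  then show thesis using that by (simp add: cong_iff_dvd_diff)
qed

text \<open>A scalar matrix of determinant 1 satisfies \<open>P dvd (a - 1) * (a + 1)\<close>, so
  the scalar is 1 or -1.\<close>

lemma Z_iff:
  assumes "mk a b c d \<in> carrier G"
  shows "mk a b c d \<in> Z \<longleftrightarrow> P dvd b \<and> P dvd c \<and> P dvd a - d"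
proof
  assume "mk a b c d \<in> Z"
  then have "P dvd a - 1 \<and> P dvd b \<and> P dvd c \<and> P dvd d - 1 \<or>
      P dvd a + 1 \<and> P dvd b \<and> P dvd c \<and> P dvd d + 1"
    by (auto simp: Z_def mk_eq_iff)
  then show "P dvd b \<and> P dvd c \<and> P dvd a - d"
    using dvd_diff[of P "a - 1" "d - 1"] dvd_diff[of P "a + 1" "d + 1"] by auto
next
  assume "P dvd b \<and> P dvd c \<and> P dvd a - d"
  then have *: "P dvd b" "P dvd c" "P dvd a - d" by auto
  have "P dvd a * d - b * c - 1"
    using assms by (simp add: mem_G cong_iff_dvd_diff)
  with *(1,3) have "P dvd (a - 1) * (a + 1)" by Groebner_Basis.algebra
  then have "P dvd a - 1 \<or> P dvd a + 1" by (simp add: dvd_mult_iff)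
  then show "mk a b c d \<in> Z"
  proof
    assume "P dvd a - 1"
    with *(3) have "P dvd d - 1" by Groebner_Basis.algebra
    with * \<open>P dvd a - 1\<close> show ?thesis by (simp add: Z_def mk_eq_iff)
  next
    assume "P dvd a + 1"
    with *(3) have "P dvd d + 1" by Groebner_Basis.algebra
    with * \<open>P dvd a + 1\<close> show ?thesis by (simp add: Z_def mk_eq_iff)
  qed
qed

lemma Z_mem: "mk 1 0 0 1 \<in> carrier G" "mk (-1) 0 0 (-1) \<in> carrier G"
  by (simp_all add: mem_G)

lemma Z_neq: "mk 1 0 0 1 \<noteq> mk (-1) 0 0 (-1)"
  using not_dvd_2 by (simp add: mk_eq_iff)

lemma card_Z: "card Z = 2"
  using Z_neq by (simp add: Z_def)

lemma Z_subset: "Z \<subseteq> carrier G" using Z_mem by (auto simp: Z_def)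

text \<open>Commuting with the two elementary matrices \<open>mk 1 1 0 1\<close> and
  \<open>mk 1 0 1 1\<close> already forces a matrix to be scalar.\<close>

lemma center_eq: "center G = Z"
proof
  show "Z \<subseteq> center G"
  proof
    fix z assume "z \<in> Z"
    moreover have "z \<otimes>\<^bsub>G\<^esub> g = g \<otimes>\<^bsub>G\<^esub> z" if "g \<in> carrier G" for g
    proof -
      obtain a b c d where "g = mk a b c d" using \<open>g \<in> carrier G\<close> by (rule G_cases)
      then show ?thesis using \<open>z \<in> Z\<close> by (auto simp: Z_def)
    qed
    ultimately show "z \<in> center G" using Z_subset by (auto simp: center_def)
  qed
  show "center G \<subseteq> Z"
  proof
    fix z assume z: "z \<in> center G"
    then have zG: "z \<in> carrier G" by (simp add: center_def)
    then obtain a b c d where abcd: "z = mk a b c d" by (rule G_cases)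
    have "mk 1 1 0 1 \<in> carrier G" "mk 1 0 1 1 \<in> carrier G" by (simp_all add: mem_G)
    then have "z \<otimes>\<^bsub>G\<^esub> mk 1 1 0 1 = mk 1 1 0 1 \<otimes>\<^bsub>G\<^esub> z" "z \<otimes>\<^bsub>G\<^esub> mk 1 0 1 1 = mk 1 0 1 1 \<otimes>\<^bsub>G\<^esub> z"
      using z by (simp_all add: center_def)
    then show "z \<in> Z"
      using zG Z_iff[of a b c d] by (simp add: abcd mk_eq_iff)
  qed
qed

text \<open>The right side lists the 2 by 2 minors of the vectors \<open>(b, c, a - d)\<close> and
  \<open>(b', c', a' - d')\<close>: matrices commute when these vectors are parallel. The vector
  vanishes exactly for scalar matrices.\<close>

lemma commute_iff:
  "mk a b c d \<otimes>\<^bsub>G\<^esub> mk a' b' c' d' = mk a' b' c' d' \<otimes>\<^bsub>G\<^esub> mk a b c d \<longleftrightarrow>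
    P dvd b * c' - b' * c \<and> P dvd b * (a' - d') - b' * (a - d) \<and> P dvd c * (a' - d') - c' * (a - d)"
proof -
  have "P dvd a * b' + b * d' - (a' * b + b' * d) \<longleftrightarrow> P dvd b * (a' - d') - b' * (a - d)"
    by (subst dvd_minus_iff[symmetric]) (simp add: algebra_simps)
  moreover have "P dvd c * b' + d * d' - (c' * b + d' * d) \<longleftrightarrow> P dvd b * c' - b' * c"
    by (subst dvd_minus_iff[symmetric]) (simp add: algebra_simps)
  moreover have "c * a' + d * c' - (c' * a + d' * c) = c * (a' - d') - c' * (a - d)"
    "a * a' + b * c' - (a' * a + b' * c) = b * c' - b' * c"
    by (simp_all add: algebra_simps)
  ultimately show ?thesis
    unfolding mat2_mult mk_eq_iff by auto
qed

text \<open>Each minor of \<open>u\<close> and \<open>w\<close> is annihilated by every coordinate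
  of \<open>v\<close>, and one of these coordinates is invertible.\<close>

lemma parallel_trans:
  assumes uv: "P dvd u1 * v2 - v1 * u2" "P dvd u1 * v3 - v1 * u3" "P dvd u2 * v3 - v2 * u3"
    and vw: "P dvd v1 * w2 - w1 * v2" "P dvd v1 * w3 - w1 * v3" "P dvd v2 * w3 - w2 * v3"
    and nz: "\<not> (P dvd v1 \<and> P dvd v2 \<and> P dvd v3)"
  shows "P dvd u1 * w2 - w1 * u2 \<and> P dvd u1 * w3 - w1 * u3 \<and> P dvd u2 * w3 - w2 * u3"
proof -
  have "P dvd v1 * (u1 * w2 - w1 * u2)" "P dvd v2 * (u1 * w2 - w1 * u2)"
    using uv(1) vw(1) by Groebner_Basis.algebra+
  moreover have "P dvd v3 * (u1 * w2 - w1 * u2)"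
    using uv(1) vw(2,3) by Groebner_Basis.algebra
  moreover have "P dvd v1 * (u1 * w3 - w1 * u3)" "P dvd v3 * (u1 * w3 - w1 * u3)"
    using uv(2) vw(2) by Groebner_Basis.algebra+
  moreover have "P dvd v2 * (u1 * w3 - w1 * u3)"
    using uv(2) vw(1,3) by Groebner_Basis.algebra
  moreover have "P dvd v2 * (u2 * w3 - w2 * u3)" "P dvd v3 * (u2 * w3 - w2 * u3)"
    using uv(3) vw(3) by Groebner_Basis.algebra+
  moreover have "P dvd v1 * (u2 * w3 - w2 * u3)"
    using uv(3) vw(1,2) by Groebner_Basis.algebra
  ultimately show ?thesis using nz by (auto simp: dvd_mult_iff)
qed

lemma G_comm_trans:
  assumes "A \<in> carrier G - Z" "B \<in> carrier G - Z" "C \<in> carrier G - Z"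
    "A \<otimes>\<^bsub>G\<^esub> B = B \<otimes>\<^bsub>G\<^esub> A" "B \<otimes>\<^bsub>G\<^esub> C = C \<otimes>\<^bsub>G\<^esub> B"
  shows "A \<otimes>\<^bsub>G\<^esub> C = C \<otimes>\<^bsub>G\<^esub> A"
proof -
  obtain a b c d where A: "A = mk a b c d" using assms by (auto elim: G_cases)
  obtain a' b' c' d' where B: "B = mk a' b' c' d'" using assms by (auto elim: G_cases)
  obtain a'' b'' c'' d'' where C: "C = mk a'' b'' c'' d''" using assms by (auto elim: G_cases)
  have "\<not> (P dvd b' \<and> P dvd c' \<and> P dvd a' - d')"
    using assms(2) Z_iff[of a' b' c' d'] by (simp add: B)
  then show ?thesis
    using assms(4,5) parallel_trans[of b c' b' c "a' - d'" "a - d" c'' b'' "a'' - d''"]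
    unfolding A B C commute_iff by blast
qed

lemma parallel_scalar:
  assumes uv: "P dvd u1 * v2 - v1 * u2" "P dvd u1 * v3 - v1 * u3" "P dvd u2 * v3 - v2 * u3"
    and nz: "\<not> (P dvd v1 \<and> P dvd v2 \<and> P dvd v3)"
  obtains l where "P dvd u1 - l * v1" "P dvd u2 - l * v2" "P dvd u3 - l * v3"
proof -
  consider "\<not> P dvd v1" | "\<not> P dvd v2" | "\<not> P dvd v3" using nz by blast
  then show thesis
  proof cases
    case 1
    then obtain i where i: "P dvd v1 * i - 1" by (rule inverse_mod)
    show thesis
    proof (rule that)
      show "P dvd u1 - (u1 * i) * v1" using i by Groebner_Basis.algebra
      show "P dvd u2 - (u1 * i) * v2" using i uv(1) by Groebner_Basis.algebra
      show "P dvd u3 - (u1 * i) * v3" using i uv(2) by Groebner_Basis.algebra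
    qed
  next
    case 2
    then obtain i where i: "P dvd v2 * i - 1" by (rule inverse_mod)
    show thesis
    proof (rule that)
      show "P dvd u1 - (u2 * i) * v1" using i uv(1) by Groebner_Basis.algebra
      show "P dvd u2 - (u2 * i) * v2" using i by Groebner_Basis.algebra
      show "P dvd u3 - (u2 * i) * v3" using i uv(3) by Groebner_Basis.algebra
    qed
  next
    case 3
    then obtain i where i: "P dvd v3 * i - 1" by (rule inverse_mod)
    show thesis
    proof (rule that)
      show "P dvd u1 - (u3 * i) * v1" using i uv(2) by Groebner_Basis.algebra
      show "P dvd u2 - (u3 * i) * v2" using i uv(3) by Groebner_Basis.algebra
      show "P dvd u3 - (u3 * i) * v3" using i by Groebner_Basis.algebra
    qed
  qed
qed

definition trace :: "int mat \<Rightarrow> int" where "trace A = A $$ (0, 0) + A $$ (1, 1)"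

lemma trace_mk: "P dvd trace (mk a b c d) - (a + d)"
  unfolding trace_def by (simp flip: cong_iff_dvd_diff add: cong_def mod_add_eq)

text \<open>In the algebra generated by a semisimple \<open>A\<close>, the elements with the characteristic
  polynomial of \<open>A\<close> are \<open>A\<close> and its algebraic conjugate, which is \<open>inv A\<close> when the determinant is 1.\<close>

lemma G_conj_commuting:
  assumes A: "A \<in> carrier G - Z" and ss: "\<not> P dvd (trace A)\<^sup>2 - 4" and H: "H \<in> carrier G"
    and comm: "(H \<otimes>\<^bsub>G\<^esub> A \<otimes>\<^bsub>G\<^esub> inv\<^bsub>G\<^esub> H) \<otimes>\<^bsub>G\<^esub> A = A \<otimes>\<^bsub>G\<^esub> (H \<otimes>\<^bsub>G\<^esub> A \<otimes>\<^bsub>G\<^esub> inv\<^bsub>G\<^esub> H)"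
  shows "H \<otimes>\<^bsub>G\<^esub> A \<otimes>\<^bsub>G\<^esub> inv\<^bsub>G\<^esub> H \<in> {A, inv\<^bsub>G\<^esub> A}"
proof -
  obtain a b c d where mkA: "A = mk a b c d" and detA: "[a * d - b * c = 1] (mod P)"
    using A by (auto elim: G_cases)
  obtain e f g h where mkH: "H = mk e f g h" and detH: "[e * h - f * g = 1] (mod P)"
    using H by (auto elim: G_cases)
  define B where "B = H \<otimes>\<^bsub>G\<^esub> A \<otimes>\<^bsub>G\<^esub> inv\<^bsub>G\<^esub> H"
  have BG: "B \<in> carrier G" unfolding B_def using A H by simp
  obtain a' b' c' d' where mkB: "B = mk a' b' c' d'" and detB: "[a' * d' - b' * c' = 1] (mod P)"
    using BG by (auto elim: G_cases)
  have dets: "P dvd a * d - b * c - 1" "P dvd a' * d' - b' * c' - 1" "P dvd e * h - f * g - 1"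
    using detA detB detH by (simp_all add: cong_iff_dvd_diff)
  have "mk a' b' c' d' = mk e f g h \<otimes>\<^bsub>G\<^esub> mk a b c d \<otimes>\<^bsub>G\<^esub> mk h (- f) (- g) e"
    using B_def unfolding mkB mkH mkA inv_mk[OF detH] .
  then have "P dvd a' - ((e * a + f * c) * h - (e * b + f * d) * g)"
    "P dvd d' - ((g * b + h * d) * e - (g * a + h * c) * f)"
    by (simp_all add: mk_eq_iff)
  then have tr_eq: "P dvd a' + d' - (a + d)"
    using dets(3) by Groebner_Basis.algebra
  have nz: "\<not> (P dvd b \<and> P dvd c \<and> P dvd a - d)"
    using A Z_iff[of a b c d] by (simp add: mkA)
  have "B \<otimes>\<^bsub>G\<^esub> A = A \<otimes>\<^bsub>G\<^esub> B" using comm unfolding B_def .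
  then have "P dvd b' * c - b * c'" "P dvd b' * (a - d) - b * (a' - d')" "P dvd c' * (a - d) - c * (a' - d')"
    unfolding mkA mkB commute_iff by auto
  then obtain l where l: "P dvd b' - l * b" "P dvd c' - l * c" "P dvd a' - d' - l * (a - d)"
    using nz by (rule parallel_scalar)
  \<comment> \<open>Equal traces and determinants give equal discriminants, but the discriminant of
    \<open>B\<close> is \<open>l ^ 2\<close> times that of \<open>A\<close>, which is
    \<open>(a + d) ^ 2 - 4\<close>.\<close>
  have "P dvd (l - 1) * ((l + 1) * ((a + d)\<^sup>2 - 4))"
    using l tr_eq dets(1,2) by Groebner_Basis.algebra
  moreover have "\<not> P dvd (a + d)\<^sup>2 - 4"
  proof
    assume "P dvd (a + d)\<^sup>2 - 4"
    with trace_mk[of a b c d] have "P dvd (trace (mk a b c d))\<^sup>2 - 4" by Groebner_Basis.algebra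
    with ss show False by (simp add: mkA)
  qed
  ultimately consider "P dvd l - 1" | "P dvd l + 1" by (auto simp: dvd_mult_iff)
  then have "B = A \<or> B = mk d (- b) (- c) a"
  proof cases
    case 1
    with l(1,2) have "P dvd b' - b" "P dvd c' - c" by Groebner_Basis.algebra+
    moreover have "P dvd 2 * (a' - a)" "P dvd 2 * (d' - d)"
      using l(3) tr_eq 1 by Groebner_Basis.algebra+
    then have "P dvd a' - a" "P dvd d' - d" by (simp_all only: dvd_2_mult_iff)
    ultimately show ?thesis by (simp add: mkA mkB mk_eq_iff)
  next
    case 2
    with l(1,2) have "P dvd b' - (- b)" "P dvd c' - (- c)" by Groebner_Basis.algebra+
    moreover have "P dvd 2 * (a' - d)" "P dvd 2 * (d' - a)"
      using l(3) tr_eq 2 by Groebner_Basis.algebra+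
    then have "P dvd a' - d" "P dvd d' - a" by (simp_all only: dvd_2_mult_iff)
    ultimately show ?thesis by (simp add: mkA mkB mk_eq_iff)
  qed
  then show ?thesis
    unfolding B_def[symmetric] using inv_mk[OF detA] by (simp add: mkA)
qed

text \<open>Comparing \<open>A\<close> with its adjugate gives \<open>2 * b\<close>,
  \<open>2 * c\<close> and \<open>d - a\<close> divisible by \<open>P\<close>, and 2 is
  invertible.\<close>

lemma G_involution:
  assumes "A \<in> carrier G" "A \<otimes>\<^bsub>G\<^esub> A = \<one>\<^bsub>G\<^esub>"
  shows "A \<in> Z"
proof -
  obtain a b c d where A: "A = mk a b c d" and detA: "[a * d - b * c = 1] (mod P)"
    using assms by (auto elim: G_cases)
  have "inv\<^bsub>G\<^esub> A = A" using assms by (simp add: G.inv_equality)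
  then have "mk d (- b) (- c) a = mk a b c d"
    unfolding A inv_mk[OF detA] .
  then have "P dvd - 2 * b" "P dvd - 2 * c" "P dvd d - a"
    by (simp_all add: mk_eq_iff)
  then have "P dvd b" "P dvd c" "P dvd a - d"
    by (simp_all add: dvd_diff_commute)
  then show ?thesis
    using Z_iff[of a b c d] assms(1) by (simp add: A)
qed


section \<open>Transvections and generation\<close>

lemma p_neq_Suc_0 [simp]: "p \<noteq> Suc 0"
  using p_gt_1 by simp

lemma not_dvd_of_dvd_mult_diff_1:
  assumes "P dvd a * b - 1" shows "\<not> P dvd a"
proof
  assume "P dvd a"
  then have "P dvd a * b" by simp
  with assms have "P dvd 1" by (metis dvd_diff_right_iff)
  then show False by simp
qed

text \<open>The map \<open>x \<mapsto> x + k det(w, x) w\<close> with \<open>w = (u, v)\<close>.\<close>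

definition transvection :: "int \<Rightarrow> int \<Rightarrow> int \<Rightarrow> int mat"
  where "transvection k u v = mk (1 - k * u * v) (k * u * u) (- (k * v * v)) (1 + k * u * v)"

lemma transvection_mem: "transvection k u v \<in> carrier G"
proof -
  have "(1 - k * u * v) * (1 + k * u * v) - (k * u * u) * (- (k * v * v)) = 1"
    by (simp add: algebra_simps)
  then show ?thesis by (simp add: transvection_def mem_G)
qed

lemma transvection_zero: "transvection 0 u v = \<one>\<^bsub>G\<^esub>"
  by (simp add: transvection_def one_G)

lemma transvection_add: "transvection k u v \<otimes>\<^bsub>G\<^esub> transvection l u v = transvection (k + l) u v"
  by (simp add: transvection_def algebra_simps)

lemma transvection_scale: "transvection k (c * u) (c * v) = transvection (k * c * c) u v"
  by (simp add: transvection_def algebra_simps)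

lemma transvection_cong:
  assumes "P dvd k - l" "P dvd u - u'" "P dvd v - v'"
  shows "transvection k u v = transvection l u' v'"
proof -
  have "P dvd (1 - k * u * v) - (1 - l * u' * v')" "P dvd (1 + k * u * v) - (1 + l * u' * v')"
    using assms by Groebner_Basis.algebra+
  moreover have "P dvd k * u * u - l * u' * u'"
    using assms(1,2) by Groebner_Basis.algebra
  moreover have "P dvd - (k * v * v) - - (l * v' * v')"
    using assms(1,3) by Groebner_Basis.algebra
  ultimately show ?thesis by (simp add: transvection_def mk_eq_iff)
qed

text \<open>Conjugation moves the direction \<open>(u, v)\<close> to its image and keeps
  \<open>k\<close>, because a matrix of determinant 1 preserves the form det(w, x).\<close>

lemma transvection_conj:
  assumes "[a * d - b * c = 1] (mod P)"
  shows "transvection k (a * u + b * v) (c * u + d * v) =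
    mk a b c d \<otimes>\<^bsub>G\<^esub> transvection k u v \<otimes>\<^bsub>G\<^esub> inv\<^bsub>G\<^esub> (mk a b c d)"
proof -
  define s t where "s = a * u + b * v" and "t = c * u + d * v"
  have det: "P dvd a * d - b * c - 1" using assms by (simp add: cong_iff_dvd_diff)
  have "transvection k s t \<otimes>\<^bsub>G\<^esub> mk a b c d = mk a b c d \<otimes>\<^bsub>G\<^esub> transvection k u v"
    unfolding transvection_def mat2_mult mk_eq_iff
  proof (intro conjI)
    show "P dvd (1 - k * s * t) * a + k * s * s * c - (a * (1 - k * u * v) + b * - (k * v * v))"
      using det unfolding s_def t_def by Groebner_Basis.algebra
    show "P dvd (1 - k * s * t) * b + k * s * s * d - (a * (k * u * u) + b * (1 + k * u * v))"
      using det unfolding s_def t_def by Groebner_Basis.algebra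
    show "P dvd - (k * t * t) * a + (1 + k * s * t) * c - (c * (1 - k * u * v) + d * - (k * v * v))"
      using det unfolding s_def t_def by Groebner_Basis.algebra
    show "P dvd - (k * t * t) * b + (1 + k * s * t) * d - (c * (k * u * u) + d * (1 + k * u * v))"
      using det unfolding s_def t_def by Groebner_Basis.algebra
  qed
  moreover have "mk a b c d \<in> carrier G" using assms by (simp add: mem_G)
  ultimately show ?thesis
    unfolding s_def t_def using transvection_mem by (metis G.inv_solve_right' G.m_closed)
qed

lemma transvection_conj_mem:
  assumes H: "subgroup H G" and A: "mk a b c d \<in> H" and transvection: "transvection k u v \<in> H"
  shows "transvection k (a * u + b * v) (c * u + d * v) \<in> H"
proof -
  have "mk a b c d \<in> carrier G" using subgroup.mem_carrier[OF H A] .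
  then have det: "[a * d - b * c = 1] (mod P)" by (simp add: mem_G)
  show ?thesis
    unfolding transvection_conj[OF det] using H A transvection by (simp add: subgroup.m_closed subgroup.m_inv_closed)
qed

text \<open>In a fixed direction transvections add in \<open>k\<close>, and the multiples of a
  nonzero \<open>k\<close> exhaust the residues.\<close>

lemma transvection_mult_mem:
  assumes H: "subgroup H G" and transvection: "transvection k u v \<in> H" and k: "\<not> P dvd k"
  shows "transvection l u v \<in> H"
proof -
  have mult: "transvection (int n * k) u v \<in> H" for n
  proof (induction n)
    case 0
    then show ?case using subgroup.one_closed[OF H] by (simp add: transvection_zero)
  next
    case (Suc n)
    then have "transvection k u v \<otimes>\<^bsub>G\<^esub> transvection (int n * k) u v \<in> H"
      using subgroup.m_closed[OF H] transvection by blast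
    then show ?case by (simp add: transvection_add algebra_simps)
  qed
  obtain i where i: "P dvd k * i - 1" using inverse_mod[OF k] .
  define n where "n = nat ((l * i) mod P)"
  have "int n = (l * i) mod P" using p_gt_0 by (simp add: n_def)
  then have "P dvd l * i - int n"
    by (simp add: mod_eq_dvd_iff[symmetric])
  with i have "P dvd int n * k - l" by Groebner_Basis.algebra
  then have "transvection (int n * k) u v = transvection l u v" by (intro transvection_cong) auto
  then show ?thesis using mult[of n] by simp
qed

lemma transvection_span_mem:
  assumes H: "subgroup H G" and uv: "\<And>k. transvection k u v \<in> H" and uv': "\<And>k. transvection k u' v' \<in> H"
    and indep: "\<not> P dvd u * v' - u' * v"
  shows "transvection k s t \<in> H"
proof -
  obtain i where i: "P dvd (u * v' - u' * v) * i - 1" using inverse_mod[OF indep] .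
  \<comment> \<open>Cramer's rule: the coordinates of \<open>(s, t)\<close> in the basis
    \<open>(u, v)\<close>, \<open>(u', v')\<close>.\<close>
  define \<alpha> \<beta> where "\<alpha> = (s * v' - u' * t) * i" and "\<beta> = (u * t - v * s) * i"
  have st: "P dvd s - (\<alpha> * u + \<beta> * u')" "P dvd t - (\<alpha> * v + \<beta> * v')"
    unfolding \<alpha>_def \<beta>_def using i by Groebner_Basis.algebra+
  show ?thesis
  proof (cases "P dvd \<beta>")
    case True
    have "P dvd s - \<alpha> * u" using st(1) True by Groebner_Basis.algebra
    moreover have "P dvd t - \<alpha> * v" using st(2) True by Groebner_Basis.algebra
    ultimately have "transvection k s t = transvection k (\<alpha> * u) (\<alpha> * v)" by (intro transvection_cong) auto
    then show ?thesis using uv by (simp add: transvection_scale)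
  next
    case False
    then obtain j where j: "P dvd \<beta> * j - 1" by (rule inverse_mod)
    \<comment> \<open>With this parameter the transvection along \<open>(u, v)\<close> carries
      \<open>(u', v')\<close> to \<open>(x, y)\<close>, which is \<open>(s, t)\<close> divided by
      \<beta>; conjugation then yields all transvections along \<open>(x, y)\<close>.\<close>
    define \<kappa> where "\<kappa> = \<alpha> * j * i"
    define x y where "x = (1 - \<kappa> * u * v) * u' + (\<kappa> * u * u) * v'"
      and "y = - (\<kappa> * v * v) * u' + (1 + \<kappa> * u * v) * v'"
    have xy: "transvection l x y \<in> H" for l
      unfolding x_def y_def using transvection_conj_mem[OF H uv[of \<kappa>, unfolded transvection_def] uv'] .
    have "P dvd \<beta> * \<kappa> * (u * v' - u' * v) - \<alpha>"
      unfolding \<kappa>_def using i j by Groebner_Basis.algebra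
    moreover have "\<beta> * x = \<beta> * u' + \<beta> * \<kappa> * (u * v' - u' * v) * u"
      "\<beta> * y = \<beta> * v' + \<beta> * \<kappa> * (u * v' - u' * v) * v"
      by (simp_all add: x_def y_def algebra_simps)
    ultimately have "P dvd \<beta> * x - (\<alpha> * u + \<beta> * u')" "P dvd \<beta> * y - (\<alpha> * v + \<beta> * v')"
      by Groebner_Basis.algebra+
    then have "P dvd s - \<beta> * x" "P dvd t - \<beta> * y"
      using st by (metis cong_iff_dvd_diff cong_sym cong_trans)+
    then have "transvection k s t = transvection k (\<beta> * x) (\<beta> * y)" by (intro transvection_cong) auto
    then show ?thesis using xy by (simp add: transvection_scale)
  qed
qed

lemma subgroup_eq_carrier_if_transvections:
  assumes H: "subgroup H G" and transvection: "\<And>k u v. transvection k u v \<in> H"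
  shows "H = carrier G"
proof
  show "H \<subseteq> carrier G" using subgroup.subset[OF H] .
  have E: "mk 1 k 0 1 \<in> H" for k using transvection[of k 1 0] by (simp add: transvection_def)
  have F: "mk 1 0 k 1 \<in> H" for k using transvection[of "- k" 0 1] by (simp add: transvection_def)
  \<comment> \<open>With invertible lower left entry the matrix is a product of an upper, a lower
    and an upper elementary matrix.\<close>
  have main: "mk a b c d \<in> H" if det: "P dvd a * d - b * c - 1" and c: "\<not> P dvd c" for a b c d
  proof -
    obtain i where i: "P dvd c * i - 1" using inverse_mod[OF c] .
    define x y where "x = (a - 1) * i" and "y = (d - 1) * i"
    have xy: "P dvd 1 + x * c - a" "P dvd c * y + 1 - d"
      unfolding x_def y_def using i by Groebner_Basis.algebra+
    have "P dvd ((1 + x * c) * y + x) - (a * y + x)"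
      using xy(1) by Groebner_Basis.algebra
    moreover have "P dvd a * y + x - b"
      unfolding x_def y_def using i det by Groebner_Basis.algebra
    ultimately have "P dvd (1 + x * c) * y + x - b"
      by (metis cong_iff_dvd_diff cong_trans)
    with xy have "mk 1 x 0 1 \<otimes>\<^bsub>G\<^esub> mk 1 0 c 1 \<otimes>\<^bsub>G\<^esub> mk 1 y 0 1 = mk a b c d"
      by (simp add: mk_eq_iff)
    then show ?thesis using E F subgroup.m_closed[OF H] by metis
  qed
  show "carrier G \<subseteq> H"
  proof
    fix A assume "A \<in> carrier G"
    then obtain a b c d where A: "A = mk a b c d" and "[a * d - b * c = 1] (mod P)"
      by (rule G_cases)
    then have det: "P dvd a * d - b * c - 1" by (simp add: cong_iff_dvd_diff)
    show "A \<in> H"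
    proof (cases "P dvd c")
      case False
      then show ?thesis using main det A by blast
    next
      case True
      \<comment> \<open>Here \<open>a\<close> is invertible, so adding the first row to the second
        leads back to the previous case.\<close>
      have "P dvd a * d - 1" using True det by Groebner_Basis.algebra
      then have "\<not> P dvd a" by (rule not_dvd_of_dvd_mult_diff_1)
      with True have "\<not> P dvd a + c" by (simp add: dvd_add_left_iff)
      moreover have "P dvd a * (b + d) - b * (a + c) - 1" using det by (simp add: algebra_simps)
      ultimately have "mk 1 0 (-1) 1 \<otimes>\<^bsub>G\<^esub> mk a b (a + c) (b + d) \<in> H"
        using main F subgroup.m_closed[OF H] by metis
      then show ?thesis by (simp add: A)
    qed
  qed
qed

text \<open>The hypothesis says that the matrix minus the identity has square 0. If \<open>b\<close>
  is invertible, the direction is \<open>(1, - \<alpha> / b)\<close> with factor \<open>b\<close>;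
  otherwise \<alpha> vanishes too and the direction is \<open>(0, 1)\<close>.\<close>

lemma nilpotent_rank_one:
  assumes "P dvd \<alpha> * \<alpha> + b * c"
  obtains k u v where "transvection k u v = mk (1 + \<alpha>) b c (1 - \<alpha>)"
proof (cases "P dvd b")
  case True
  with assms have "P dvd \<alpha> * \<alpha>" by (simp add: dvd_add_left_iff)
  then have "P dvd \<alpha>" by (simp add: dvd_mult_iff)
  with True have "transvection (- c) 0 1 = mk (1 + \<alpha>) b c (1 - \<alpha>)"
    by (simp add: transvection_def mk_eq_iff)
  then show thesis by (rule that)
next
  case False
  then obtain i where i: "P dvd b * i - 1" by (rule inverse_mod)
  have "P dvd (1 - b * 1 * (- \<alpha> * i)) - (1 + \<alpha>)" "P dvd (1 + b * 1 * (- \<alpha> * i)) - (1 - \<alpha>)"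
    using i by Groebner_Basis.algebra+
  moreover have "P dvd - (b * (- \<alpha> * i) * (- \<alpha> * i)) - c"
    using i assms by Groebner_Basis.algebra
  ultimately have "transvection b 1 (- \<alpha> * i) = mk (1 + \<alpha>) b c (1 - \<alpha>)"
    unfolding transvection_def mk_eq_iff by simp
  then show thesis by (rule that)
qed

lemma transvection_mem_Z:
  assumes "P dvd k \<or> P dvd u \<and> P dvd v"
  shows "transvection k u v \<in> Z"
proof -
  have "transvection k u v = transvection 0 0 0"
    using assms by (auto simp: transvection_def mk_eq_iff)
  then show ?thesis by (simp add: Z_def transvection_def)
qed

lemma finite_G: "finite (carrier G)"
proof (rule finite_surj)
  show "carrier G \<subseteq> (\<lambda>(a, b, c, d). mk a b c d) ` ({0..<P} \<times> {0..<P} \<times> {0..<P} \<times> {0..<P})"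
  proof
    fix A assume "A \<in> carrier G"
    then obtain a b c d where "A = mk a b c d" by (rule G_cases)
    then have "A = mk (a mod P) (b mod P) (c mod P) (d mod P)"
      by (simp add: mat2_eq_iff cong_def)
    then show "A \<in> (\<lambda>(a, b, c, d). mk a b c d) ` ({0..<P} \<times> {0..<P} \<times> {0..<P} \<times> {0..<P})"
      using p_gt_0 by (auto intro!: image_eqI[where x = "(a mod P, b mod P, c mod P, d mod P)"])
  qed
qed simp

lemma Z_normal: "Z \<lhd> G"
  using G.center_normal by (simp add: center_eq)

lemma Z_commute: "A \<in> Z \<Longrightarrow> B \<in> carrier G \<Longrightarrow> A \<otimes>\<^bsub>G\<^esub> B = B \<otimes>\<^bsub>G\<^esub> A"
  by (simp add: center_eq[symmetric] center_def)

text \<open>The condition on traces excludes double eigenvalues and enters through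
  \<open>conj_commuting\<close>; the other axioms are inherited from SL(2, p).\<close>

lemma semisimple_subgroup_torus_group:
  assumes H: "subgroup H G" and ZH: "Z \<subseteq> H"
    and ss: "\<And>A. A \<in> H - Z \<Longrightarrow> \<not> P dvd (trace A)\<^sup>2 - 4"
  shows "torus_group (G\<lparr>carrier := H\<rparr>) Z"
proof -
  let ?K = "G\<lparr>carrier := H\<rparr>"
  interpret K: group ?K by (rule G.subgroup_imp_group[OF H])
  have HG: "A \<in> carrier G" if "A \<in> H" for A using subgroup.mem_carrier[OF H that] .
  show ?thesis
  proof (intro torus_group.intro torus_group_axioms.intro K.is_group, goal_cases)
    case 1
    show ?case using finite_subset[OF subgroup.subset[OF H] finite_G] by simp
  next
    case 2
    show ?case using G.subgroup_incl[OF normal_imp_subgroup[OF Z_normal] H ZH] .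
  next
    case 3
    show ?case by (rule card_Z)
  next
    case (4 z g)
    then show ?case using Z_commute HG by simp
  next
    case (5 a b c)
    then show ?case using G_comm_trans[of a b c] HG by simp
  next
    case (6 a h)
    then show ?case
      using G_conj_commuting[of a h] HG ss[of a] by (simp add: G.m_inv_consistent[OF H])
  next
    case (7 a)
    then show ?case using G_involution[of a] HG by simp
  qed
qed

text \<open>After multiplication by -1 if necessary, \<open>A\<close> has trace 2 and is a
  nontrivial transvection. All transvections in its direction follow, and conjugation supplies a
  second direction.\<close>

lemma subgroup_generated_by_non_semisimple:
  assumes H: "subgroup H G" and ZH: "Z \<subseteq> H"
    and X: "mk z 0 0 w \<in> H" "\<not> P dvd z - w"
    and Y: "mk a b c d \<in> H" "\<not> P dvd b" "\<not> P dvd c"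
    and A: "A \<in> H - Z" "P dvd (trace A)\<^sup>2 - 4"
  shows "H = carrier G"
proof -
  have HG: "B \<in> carrier G" if "B \<in> H" for B using subgroup.mem_carrier[OF H that] .
  have "A \<in> carrier G" using A HG by blast
  then obtain a1 b1 c1 d1 where A1: "A = mk a1 b1 c1 d1" "[a1 * d1 - b1 * c1 = 1] (mod P)"
    by (rule G_cases)
  have det1: "P dvd a1 * d1 - b1 * c1 - 1" using A1(2) by (simp add: cong_iff_dvd_diff)
  have "P dvd (a1 + d1 - 2) * (a1 + d1 + 2)"
    using A(2) trace_mk[of a1 b1 c1 d1] unfolding A1(1) by Groebner_Basis.algebra
  then consider "P dvd a1 + d1 - 2" | "P dvd a1 + d1 + 2" by (auto simp: dvd_mult_iff)
  then obtain a2 b2 c2 d2 where A2: "mk a2 b2 c2 d2 \<in> H - Z" "P dvd a2 * d2 - b2 * c2 - 1"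
    "P dvd a2 + d2 - 2"
  proof cases
    case 1
    then show thesis using that A A1(1) det1 by blast
  next
    case 2
    have eq: "mk (-1) 0 0 (-1) \<otimes>\<^bsub>G\<^esub> A = mk (- a1) (- b1) (- c1) (- d1)"
      by (simp add: A1(1))
    have "mk (-1) 0 0 (-1) \<in> H" using ZH by (simp add: Z_def)
    then have mem: "mk (- a1) (- b1) (- c1) (- d1) \<in> H"
      using A subgroup.m_closed[OF H] by (metis DiffD1 eq)
    moreover have "mk (- a1) (- b1) (- c1) (- d1) \<notin> Z"
      using A Z_iff[of a1 b1 c1 d1] Z_iff[of "- a1" "- b1" "- c1" "- d1"] HG[OF mem] HG
      by (auto simp: A1(1) dvd_diff_commute)
    moreover have "P dvd - a1 + - d1 - 2"
      using 2 by (metis add.commute diff_minus_eq_add dvd_minus_iff minus_add_distrib minus_diff_eq)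
    ultimately show thesis using that det1 by simp
  qed
  define \<alpha> where "\<alpha> = a2 - 1"
  have "P dvd \<alpha> * \<alpha> + b2 * c2"
    unfolding \<alpha>_def using A2(2,3) by Groebner_Basis.algebra
  then obtain k u v where transvection: "transvection k u v = mk (1 + \<alpha>) b2 c2 (1 - \<alpha>)"
    by (rule nilpotent_rank_one)
  have "P dvd 1 - \<alpha> - d2" unfolding \<alpha>_def using A2(3) by (simp add: dvd_diff_commute algebra_simps)
  then have "transvection k u v = mk a2 b2 c2 d2" by (simp add: transvection mk_eq_iff \<alpha>_def)
  then have tvH: "transvection k u v \<in> H" and "transvection k u v \<notin> Z" using A2(1) by auto
  then have k: "\<not> P dvd k" and uv: "\<not> (P dvd u \<and> P dvd v)" using transvection_mem_Z by blast+
  have all: "transvection l u v \<in> H" for l using transvection_mult_mem[OF H tvH k] .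
  \<comment> \<open>The diagonal matrix moves every direction other than the two axes; the other
    matrix moves both axes, as \<open>b\<close> and \<open>c\<close> are invertible.\<close>
  obtain u' v' where uv': "\<And>l. transvection l u' v' \<in> H" "\<not> P dvd u * v' - u' * v"
  proof (cases "P dvd u * v")
    case True
    define u' v' where "u' = a * u + b * v" and "v' = c * u + d * v"
    have "\<not> P dvd u * v' - u' * v"
    proof
      assume "P dvd u * v' - u' * v"
      then have *: "P dvd c * u * u - b * v * v"
        using True unfolding u'_def v'_def by Groebner_Basis.algebra
      have "P dvd u \<or> P dvd v" using True by (simp add: dvd_mult_iff)
      then show False
      proof
        assume "P dvd u"
        with * have "P dvd b * v * v" by (simp add: dvd_diff_right_iff)
        with Y uv \<open>P dvd u\<close> show False by (simp add: dvd_mult_iff)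
      next
        assume "P dvd v"
        with * have "P dvd c * u * u" by (simp add: dvd_diff_left_iff)
        with Y uv \<open>P dvd v\<close> show False by (simp add: dvd_mult_iff)
      qed
    qed
    then show thesis using that transvection_conj_mem[OF H Y(1) all] unfolding u'_def v'_def by blast
  next
    case False
    have "u * (0 * u + w * v) - (z * u + 0 * v) * v = - ((z - w) * (u * v))"
      by (simp add: algebra_simps)
    then have "\<not> P dvd u * (0 * u + w * v) - (z * u + 0 * v) * v"
      using False X(2) by (simp only: dvd_minus_iff dvd_mult_iff) simp
    then show thesis using that transvection_conj_mem[OF H X(1) all] by blast
  qed
  show ?thesis
    using subgroup_eq_carrier_if_transvections[OF H] transvection_span_mem[OF H all uv'] by blast
qed

lemma mk_diag_pow: "mk z 0 0 w [^]\<^bsub>G\<^esub> (k::nat) = mk (z ^ k) 0 0 (w ^ k)"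
  by (induction k) (simp_all add: one_G mult.commute)

text \<open>If \<open>H\<close> has no element of trace 2 or -2 outside \<open>Z\<close>, the powers
  of the diagonal matrix with exponents below 12 are distinct members of its centralizer, which
  forces the two given matrices to commute, against the choice of \<open>b\<close>.\<close>

lemma subgroup_eq_carrier:
  assumes H: "subgroup H G" and ZH: "Z \<subseteq> H"
    and X: "mk z 0 0 w \<in> H" and z: "\<And>k. 0 < k \<Longrightarrow> k < 12 \<Longrightarrow> \<not> P dvd z ^ k - 1"
    and Y: "mk a b c d \<in> H" "\<not> P dvd b" "\<not> P dvd c"
    and YY: "mk a b c d \<otimes>\<^bsub>G\<^esub> mk a b c d \<notin> Z"
  shows "H = carrier G"
proof -
  have XG: "mk z 0 0 w \<in> carrier G" using subgroup.mem_carrier[OF H X] .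
  then have zw: "P dvd z * w - 1" by (simp add: mem_G cong_iff_dvd_diff)
  have znw: "\<not> P dvd z - w"
  proof
    assume "P dvd z - w"
    with zw have "P dvd z ^ 2 - 1" by Groebner_Basis.algebra
    then show False using z[of 2] by simp
  qed
  have nz: "\<not> P dvd z" using not_dvd_of_dvd_mult_diff_1[OF zw] .
  show ?thesis
  proof (cases "\<exists>A \<in> H - Z. P dvd (trace A)\<^sup>2 - 4")
    case True
    then show ?thesis
      using subgroup_generated_by_non_semisimple[OF H ZH X znw Y] by blast
  next
    case False
    then interpret K: torus_group "G\<lparr>carrier := H\<rparr>" Z
      by (intro semisimple_subgroup_torus_group[OF H ZH]) blast
    have "mk z 0 0 w \<notin> Z" using znw Z_iff[OF XG] by simp
    have inj: "inj_on (\<lambda>k. mk (z ^ k) 0 0 (w ^ k)) {..<12}"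
    proof (rule linorder_inj_onI)
      fix i j :: nat assume ij: "i < j" "i \<in> {..<12}" "j \<in> {..<12}"
      show "mk (z ^ i) 0 0 (w ^ i) \<noteq> mk (z ^ j) 0 0 (w ^ j)"
      proof
        assume "mk (z ^ i) 0 0 (w ^ i) = mk (z ^ j) 0 0 (w ^ j)"
        then have "P dvd z ^ j - z ^ i" by (simp add: mk_eq_iff dvd_diff_commute)
        also have "z ^ j = z ^ i * z ^ (j - i)" using ij by (simp flip: power_add)
        finally have "P dvd z ^ i * (z ^ (j - i) - 1)" by (simp add: algebra_simps)
        then have "P dvd z ^ (j - i) - 1"
          using nz prime_dvd_power[OF prime_P] by (auto simp: dvd_mult_iff)
        moreover have "j - i < 12" using ij by auto
        ultimately show False using z[of "j - i"] ij by auto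
      qed
    qed auto
    have "(\<lambda>k. mk (z ^ k) 0 0 (w ^ k)) ` {..<12} \<subseteq> K.centralizer (mk z 0 0 w)"
    proof -
      have "mk z 0 0 w [^]\<^bsub>G\<^esub> k \<in> H" for k :: nat
        using subgroup.m_closed[OF H] X subgroup.one_closed[OF H] by (induction k) auto
      then have "mk (z ^ k) 0 0 (w ^ k) \<in> H" for k by (simp add: mk_diag_pow)
      then show ?thesis by (auto simp: K.centralizer_def K.commutes_def mult.commute)
    qed
    then have "card ((\<lambda>k. mk (z ^ k) 0 0 (w ^ k)) ` {..<12::nat}) \<le> card (K.centralizer (mk z 0 0 w))"
      by (intro card_mono) auto
    then have "card (K.centralizer (mk z 0 0 w)) \<ge> 12" by (simp add: card_image[OF inj])
    then have "mk z 0 0 w \<otimes>\<^bsub>G\<^esub> mk a b c d = mk a b c d \<otimes>\<^bsub>G\<^esub> mk z 0 0 w"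
      using K.commute_of_large_centralizer[of "mk z 0 0 w" "mk a b c d"] X Y(1) YY
        \<open>mk z 0 0 w \<notin> Z\<close> by simp
    then have "P dvd b * (z - w)" unfolding commute_iff by simp
    then show ?thesis using Y(2) znw by (simp add: dvd_mult_iff)
  qed
qed


section \<open>Orders in PSL(2, p)\<close>

text \<open>The index is shifted by one: for \<open>t = z + 1/z\<close> the value is \<open>(z ^ k - z ^ (-k)) / (z - 1/z)\<close>.\<close>

fun chebyshev_S :: "int \<Rightarrow> nat \<Rightarrow> int" where
  "chebyshev_S t 0 = 0"
| "chebyshev_S t (Suc 0) = 1"
| "chebyshev_S t (Suc (Suc k)) = t * chebyshev_S t (Suc k) - chebyshev_S t k"

text \<open>By Cayley-Hamilton the square of the matrix is \<open>t\<close> times the matrix minus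
  the identity; the coefficients of its powers obey the recurrence of
  \<open>chebyshev_S\<close>.\<close>

lemma mk_pow_Suc:
  assumes det: "P dvd a * d - b * c - 1" and t: "P dvd a + d - t"
  shows "mk a b c d [^]\<^bsub>G\<^esub> Suc k =
    mk (chebyshev_S t (Suc k) * a - chebyshev_S t k) (chebyshev_S t (Suc k) * b)
      (chebyshev_S t (Suc k) * c) (chebyshev_S t (Suc k) * d - chebyshev_S t k)"
proof (induction k)
  case 0
  have "mk a b c d \<in> carrier G" using det by (simp add: mem_G cong_iff_dvd_diff)
  then show ?case by simp
next
  case (Suc k)
  define x y where "x = chebyshev_S t (Suc k)" and "y = chebyshev_S t k"
  have "mk a b c d [^]\<^bsub>G\<^esub> Suc (Suc k) = mk (x * a - y) (x * b) (x * c) (x * d - y) \<otimes>\<^bsub>G\<^esub> mk a b c d"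
    using Suc by (simp add: x_def y_def)
  also have "\<dots> = mk ((t * x - y) * a - x) ((t * x - y) * b) ((t * x - y) * c) ((t * x - y) * d - x)"
    unfolding mat2_mult mk_eq_iff
    using det t by (intro conjI) Groebner_Basis.algebra+
  finally show ?case by (simp add: x_def y_def)
qed

lemma chebyshev_S_eq:
  assumes zw: "P dvd z * w - 1"
  shows "P dvd (z - w) * chebyshev_S (z + w) k - (z ^ k - w ^ k)"
proof (induction "z + w" k rule: chebyshev_S.induct)
  case (3 k)
  define x y where "x = z ^ k" and "y = w ^ k"
  define c c' where "c = chebyshev_S (z + w) k" and "c' = chebyshev_S (z + w) (Suc k)"
  have "P dvd (z - w) * c - (x - y)" "P dvd (z - w) * c' - (z * x - w * y)"
    using 3 by (simp_all add: x_def y_def c_def c'_def)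
  then have "P dvd (z - w) * ((z + w) * c' - c) - (z * (z * x) - w * (w * y))"
    using zw by Groebner_Basis.algebra
  then show ?case by (simp add: x_def y_def c_def c'_def)
qed auto

text \<open>The power is a multiple of the matrix plus a scalar, hence scalar exactly when the
  factor \<open>chebyshev_S (z + w) k\<close> vanishes, that is, when \<open>z ^ k\<close> and its
  inverse \<open>w ^ k\<close> agree.\<close>

lemma pow_mem_Z_iff:
  assumes A: "mk a b c d \<in> carrier G - Z" and t: "P dvd a + d - (z + w)"
    and zw: "P dvd z * w - 1" and znw: "\<not> P dvd z - w"
  shows "mk a b c d [^]\<^bsub>G\<^esub> k \<in> Z \<longleftrightarrow> P dvd z ^ (2 * k) - 1"
proof -
  have AG: "mk a b c d \<in> carrier G" using A by simp
  then have det: "P dvd a * d - b * c - 1" by (simp add: mem_G cong_iff_dvd_diff)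
  have nz: "\<not> (P dvd b \<and> P dvd c \<and> P dvd a - d)" using A Z_iff[OF AG] by simp
  show ?thesis
  proof (cases k)
    case 0
    then show ?thesis by (simp add: Z_def one_G)
  next
    case (Suc m)
    define x y where "x = chebyshev_S (z + w) k" and "y = chebyshev_S (z + w) m"
    have pow: "mk a b c d [^]\<^bsub>G\<^esub> k = mk (x * a - y) (x * b) (x * c) (x * d - y)"
      using mk_pow_Suc[OF det t, of m] Suc by (simp add: x_def y_def)
    moreover have "mk a b c d [^]\<^bsub>G\<^esub> k \<in> carrier G" using AG by simp
    ultimately have "mk a b c d [^]\<^bsub>G\<^esub> k \<in> Z \<longleftrightarrow> P dvd x * b \<and> P dvd x * c \<and> P dvd (x * a - y) - (x * d - y)"
      using Z_iff by simp
    also have "(x * a - y) - (x * d - y) = x * (a - d)" by (simp add: algebra_simps)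
    finally have 1: "mk a b c d [^]\<^bsub>G\<^esub> k \<in> Z \<longleftrightarrow> P dvd x"
      using nz by (auto simp: dvd_mult_iff)
    have "P dvd x \<longleftrightarrow> P dvd (z - w) * x" using znw by (simp add: dvd_mult_iff)
    also have "\<dots> \<longleftrightarrow> P dvd z ^ k - w ^ k"
      using chebyshev_S_eq[OF zw, of k] unfolding x_def by (metis cong_dvd_iff cong_iff_dvd_diff)
    finally have 2: "P dvd x \<longleftrightarrow> P dvd z ^ k - w ^ k" .
    have "[(z * w) ^ k = 1 ^ k] (mod P)"
      using zw by (intro cong_pow) (simp add: cong_iff_dvd_diff)
    then have zwk: "P dvd z ^ k * w ^ k - 1" by (simp add: cong_iff_dvd_diff power_mult_distrib)
    have "P dvd u - v \<longleftrightarrow> P dvd u * u - 1" if "P dvd u * v - 1" for u v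
    proof
      assume "P dvd u - v"
      then show "P dvd u * u - 1" using that by Groebner_Basis.algebra
    next
      assume "P dvd u * u - 1"
      then show "P dvd u - v" using that by Groebner_Basis.algebra
    qed
    note this[OF zwk]
    then show ?thesis using 1 2 by (simp add: mult_2 power_add)
  qed
qed

section \<open>The projection from SL(2, p) to PSL(2, p)\<close>

abbreviation Q :: "int mat set monoid" where "Q \<equiv> PSL 2 p"

definition proj :: "int mat \<Rightarrow> int mat set" where "proj A = Z #>\<^bsub>G\<^esub> A"

lemma Q_eq: "Q = G Mod Z" by (simp add: PSL_def center_eq)

lemma group_hom_proj: "group_hom G Q proj"
  unfolding group_hom_def group_hom_axioms_def
  using normal.r_coset_hom_Mod[OF Z_normal] group_PSL[OF p_gt_1, of 2] G.is_group
  by (auto simp: Q_eq proj_def[abs_def])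

sublocale proj: group_hom G Q proj by (rule group_hom_proj)

lemma proj_surj: "proj ` carrier G = carrier Q"
  by (auto simp: Q_eq proj_def FactGroup_def RCOSETS_def)

lemma proj_eq_one_iff:
  assumes "A \<in> carrier G" shows "proj A = \<one>\<^bsub>Q\<^esub> \<longleftrightarrow> A \<in> Z"
proof -
  have "subgroup Z G" using normal_imp_subgroup[OF Z_normal] .
  then have "Z #>\<^bsub>G\<^esub> A = Z \<longleftrightarrow> A \<in> Z"
    using assms G.coset_join1 G.coset_join2 Z_subset by blast
  then show ?thesis by (simp add: proj_def Q_eq)
qed

lemma ord_proj:
  assumes A: "mk a b c d \<in> carrier G - Z" and t: "P dvd a + d - (z + w)"
    and zw: "P dvd z * w - 1" and znw: "\<not> P dvd z - w"
    and z: "\<And>k. P dvd z ^ k - 1 \<longleftrightarrow> 2 * r dvd k"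
  shows "group.ord Q (proj (mk a b c d)) = r"
proof -
  have AG: "mk a b c d \<in> carrier G" using A by simp
  have "proj (mk a b c d) [^]\<^bsub>Q\<^esub> k = \<one>\<^bsub>Q\<^esub> \<longleftrightarrow> r dvd k" for k :: nat
  proof -
    have "proj (mk a b c d) [^]\<^bsub>Q\<^esub> k = proj (mk a b c d [^]\<^bsub>G\<^esub> k)"
      using proj.hom_nat_pow[OF AG] by simp
    also have "\<dots> = \<one>\<^bsub>Q\<^esub> \<longleftrightarrow> mk a b c d [^]\<^bsub>G\<^esub> k \<in> Z"
      using AG by (intro proj_eq_one_iff) simp
    finally show ?thesis
      by (simp add: pow_mem_Z_iff[OF A t zw znw] z)
  qed
  then show ?thesis
    using proj.H.ord_unique[of "proj (mk a b c d)" r] AG by auto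
qed

text \<open>The elements of \<open>Z\<close> project to 1, so they may be added to the generators in
  SL(2, p).\<close>

lemma generate_proj:
  assumes "A \<in> carrier G" "B \<in> carrier G"
    and gen: "generate G (insert A (insert B Z)) = carrier G"
  shows "generate Q {proj A, proj B} = carrier Q"
proof
  show "generate Q {proj A, proj B} \<subseteq> carrier Q"
    using assms by (intro proj.H.generate_incl) auto
  have "carrier Q = generate Q (proj ` insert A (insert B Z))"
    using proj.generate_img[of "insert A (insert B Z)"] gen proj_surj assms Z_subset by simp
  also have "\<dots> \<subseteq> generate Q {proj A, proj B}"
  proof (rule proj.H.generate_subgroup_incl)
    show "subgroup (generate Q {proj A, proj B}) Q"
      using assms by (intro proj.H.generate_is_subgroup) auto
    have "proj C = \<one>\<^bsub>Q\<^esub>" if "C \<in> Z" for C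
      using that proj_eq_one_iff Z_subset by blast
    then show "proj ` insert A (insert B Z) \<subseteq> generate Q {proj A, proj B}"
      by (auto intro: generate.incl generate.one)
  qed
  finally show "carrier Q \<subseteq> generate Q {proj A, proj B}" .
qed

text \<open>The condition on \<open>z\<close> says that its order is \<open>2 * r\<close>, which is
  at least 12 and so provides the powers that \<open>subgroup_eq_carrier\<close> asks for.\<close>

theorem ex_generating_pair:
  assumes r: "r \<ge> 6" and z: "\<And>k. P dvd z ^ k - 1 \<longleftrightarrow> 2 * r dvd k"
  obtains x y where "x \<in> carrier Q" "y \<in> carrier Q" "generate Q {x, y} = carrier Q"
    "group.ord Q x = r" "group.ord Q y = r" "group.ord Q (inv\<^bsub>Q\<^esub> (x \<otimes>\<^bsub>Q\<^esub> y)) = r"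
proof -
  have z_small: "\<not> P dvd z ^ k - 1" if "0 < k" "k < 12" for k
  proof
    assume "P dvd z ^ k - 1"
    then have "2 * r \<le> k" using z that by (simp add: dvd_imp_le)
    with that r show False by simp
  qed
  have "P dvd z ^ (2 * r) - 1" by (simp add: z)
  then have "P dvd z * z ^ (2 * r - 1) - 1" using r by (simp flip: power_Suc)
  then have nz: "\<not> P dvd z" by (rule not_dvd_of_dvd_mult_diff_1)
  then obtain w where zw: "P dvd z * w - 1" by (rule inverse_mod)
  have znw: "\<not> P dvd z - w"
  proof
    assume "P dvd z - w"
    with zw have "P dvd z ^ 2 - 1" by Groebner_Basis.algebra
    then show False using z_small[of 2] by simp
  qed
  have "\<not> P dvd z + 1"
  proof
    assume "P dvd z + 1"
    then have "P dvd z ^ 2 - 1" by Groebner_Basis.algebra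
    then show False using z_small[of 2] by simp
  qed
  then obtain e where e: "P dvd (z + 1) * e - 1" by (rule inverse_mod)
  \<comment> \<open>The solution of \<open>a + d = z + w\<close>, \<open>z * a + w * d = z + w\<close>.\<close>
  define a d where "a = (z + w) * e" and "d = (z + w) * z * e"
  \<comment> \<open>The upper right entry of \<open>B\<close> is 1, so this choice gives determinant
    1.\<close>
  define c where "c = a * d - 1"
  define A B where "A = mk z 0 0 w" and "B = mk a 1 c d"
  have AG: "A \<in> carrier G" using zw by (simp add: A_def mem_G cong_iff_dvd_diff)
  have BG: "B \<in> carrier G" by (simp add: B_def mem_G c_def)
  have AB: "A \<otimes>\<^bsub>G\<^esub> B = mk (z * a) z (w * c) (w * d)" by (simp add: A_def B_def)
  have AZ: "A \<in> carrier G - Z" using AG znw Z_iff[of z 0 0 w] by (simp add: A_def)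
  have BZ: "B \<in> carrier G - Z" using BG Z_iff[of a 1 c d] by (simp add: B_def)
  have ABZ: "mk (z * a) z (w * c) (w * d) \<in> carrier G - Z"
    using G.m_closed[OF AG BG] nz Z_iff[of "z * a" z "w * c" "w * d"] by (simp add: AB)
  have trB: "P dvd a + d - (z + w)"
    unfolding a_def d_def using e by Groebner_Basis.algebra
  have trAB: "P dvd z * a + w * d - (z + w)"
    unfolding a_def d_def using e zw by Groebner_Basis.algebra
  have ordA: "group.ord Q (proj A) = r"
    unfolding A_def by (rule ord_proj[OF AZ[unfolded A_def] _ zw znw z]) simp
  have ordB: "group.ord Q (proj B) = r"
    unfolding B_def by (rule ord_proj[OF BZ[unfolded B_def] trB zw znw z])
  have "group.ord Q (proj (A \<otimes>\<^bsub>G\<^esub> B)) = r"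
    unfolding AB by (rule ord_proj[OF ABZ trAB zw znw z])
  then have ordAB: "group.ord Q (inv\<^bsub>Q\<^esub> (proj A \<otimes>\<^bsub>Q\<^esub> proj B)) = r"
    using AG BG by simp
  have c: "\<not> P dvd c"
  proof
    assume "P dvd c"
    then have "P dvd ((z + w) * e) * ((z + w) * z * e) - 1" unfolding c_def a_def d_def .
    then have "P dvd (z + w) * (z + w) * z - (z + 1) * (z + 1)"
      using e by Groebner_Basis.algebra
    \<comment> \<open>Multiplication by \<open>z\<close> clears \<open>w\<close>, its inverse, and
      the difference factors.\<close>
    then have "P dvd (z - 1) * (z ^ 3 - 1)"
      using zw by Groebner_Basis.algebra
    then show False using z_small[of 1] z_small[of 3] by (simp add: dvd_mult_iff)
  qed
  \<comment> \<open>A central square would give \<open>z ^ 4\<close> congruent to 1.\<close>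
  have "B [^]\<^bsub>G\<^esub> Suc (Suc 0) \<notin> Z"
    unfolding B_def pow_mem_Z_iff[OF BZ[unfolded B_def] trB zw znw] using z_small[of 4] by simp
  then have BB: "B \<otimes>\<^bsub>G\<^esub> B \<notin> Z" using BG by simp
  have "generate G (insert A (insert B Z)) = carrier G"
  proof (rule subgroup_eq_carrier)
    show "subgroup (generate G (insert A (insert B Z))) G"
      using AG BG Z_subset by (intro G.generate_is_subgroup) auto
    show "Z \<subseteq> generate G (insert A (insert B Z))" by (auto intro: generate.incl)
    show "mk z 0 0 w \<in> generate G (insert A (insert B Z))"
      unfolding A_def[symmetric] by (auto intro: generate.incl)
    show "mk a 1 c d \<in> generate G (insert A (insert B Z))"
      unfolding B_def[symmetric] by (auto intro: generate.incl)
    show "mk a 1 c d \<otimes>\<^bsub>G\<^esub> mk a 1 c d \<notin> Z" using BB unfolding B_def .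
  qed (use z_small c in auto)
  then have "generate Q {proj A, proj B} = carrier Q" by (rule generate_proj[OF AG BG])
  then show thesis using that[of "proj A" "proj B"] AG BG ordA ordB ordAB by simp
qed

lemma finite_Q: "finite (carrier Q)"
  using finite_G by (simp flip: proj_surj)

end


section \<open>Beauville structures\<close>

lemma (in group) pow_eq_one_of_mem_beauville_Sigma:
  assumes "x \<in> carrier G" "y \<in> carrier G" "z \<in> carrier G"
    and "ord x = n" "ord y = n" "ord z = n" and w: "w \<in> beauville_Sigma G (x, y, z)"
  shows "w \<in> carrier G \<and> w [^] n = \<one>"
proof -
  obtain g u and j :: nat where g: "g \<in> carrier G" and u: "u \<in> {x, y, z}" "w = g \<otimes> (u [^] j) \<otimes> inv g"
    using w by auto
  have uc: "u \<in> carrier G" and "ord u = n" using u assms by auto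
  have "(g \<otimes> a \<otimes> inv g) [^] k = g \<otimes> (a [^] k) \<otimes> inv g" if "a \<in> carrier G" for a and k :: nat
  proof (induction k)
    case (Suc k)
    have "inv g \<otimes> (g \<otimes> b) = b" if "b \<in> carrier G" for b
      using g that by (simp add: m_assoc[symmetric])
    then show ?case using Suc g that by (simp add: m_assoc)
  qed (use g in simp)
  moreover have "(u [^] j) [^] n = \<one>"
    using uc \<open>ord u = n\<close> by (simp add: nat_pow_pow pow_eq_id)
  ultimately show ?thesis using u g uc by simp
qed

text \<open>The order of a common element divides both \<open>m\<close> and
  \<open>n\<close>.\<close>

lemma (in group) beauville_Sigma_inter_eq_one:
  assumes "x1 \<in> carrier G" "y1 \<in> carrier G" "z1 \<in> carrier G"
    and "x2 \<in> carrier G" "y2 \<in> carrier G" "z2 \<in> carrier G"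
    and ord1: "ord x1 = m" "ord y1 = m" "ord z1 = m"
    and ord2: "ord x2 = n" "ord y2 = n" "ord z2 = n"
    and pos: "m > 0" "n > 0" and coprime: "coprime m n"
  shows "beauville_Sigma G (x1, y1, z1) \<inter> beauville_Sigma G (x2, y2, z2) = {\<one>}"
proof
  show "beauville_Sigma G (x1, y1, z1) \<inter> beauville_Sigma G (x2, y2, z2) \<subseteq> {\<one>}"
  proof
    fix w assume "w \<in> beauville_Sigma G (x1, y1, z1) \<inter> beauville_Sigma G (x2, y2, z2)"
    then have w: "w \<in> carrier G" "w [^] m = \<one>" "w [^] n = \<one>"
      using pow_eq_one_of_mem_beauville_Sigma[OF assms(1-3) ord1]
        pow_eq_one_of_mem_beauville_Sigma[OF assms(4-6) ord2] by blast+
    then have "ord w dvd m" "ord w dvd n" by (simp_all add: pow_eq_id)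
    then have "ord w = 1" using coprime coprime_common_divisor_nat by blast
    then show "w \<in> {\<one>}" using w(1) ord_eq_1 by blast
  qed
  \<comment> \<open>Exponents start at 1, so the identity is reached as \<open>x [^] k\<close> with
    \<open>k\<close> the positive order of \<open>x\<close>.\<close>
  have mem: "\<one> \<in> beauville_Sigma G (x, y, z)"
    if "x \<in> carrier G" "ord x = k" "k > 0" for x y z and k :: nat
  proof -
    have "x [^] k = \<one>" using that pow_ord_eq_1 by blast
    then have "\<one> = \<one> \<otimes> (x [^] k) \<otimes> inv \<one>" by simp
    then show ?thesis using that one_closed by (auto intro!: bexI[of _ \<one>] bexI[of _ k])
  qed
  show "{\<one>} \<subseteq> beauville_Sigma G (x1, y1, z1) \<inter> beauville_Sigma G (x2, y2, z2)"
    using mem[of x1 m] mem[of x2 n] assms by simp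
qed

lemma cong_one_power_iff:
  fixes p a s k m :: nat
  assumes "ord p a = m * s" "s > 0"
  shows "int p dvd (int a ^ s) ^ k - 1 \<longleftrightarrow> m dvd k"
proof -
  have "int p dvd (int a ^ s) ^ k - 1 \<longleftrightarrow> [int (a ^ (s * k)) = int 1] (mod int p)"
    by (simp add: cong_iff_dvd_diff power_mult)
  also have "\<dots> \<longleftrightarrow> [a ^ (s * k) = 1] (mod p)" by (simp only: cong_int_iff)
  also have "\<dots> \<longleftrightarrow> ord p a dvd s * k" by (rule ord_divides)
  also have "\<dots> \<longleftrightarrow> m dvd k" using assms by (simp add: mult.commute)
  finally show ?thesis .
qed

theorem corollary1p5:
  fixes r s :: int
  assumes "r > 5" and "s > 5" and "coprime r s"
  shows "infinite {p :: nat. prime p \<and>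
    (\<exists>x1 y1 x2 y2. unmixed_beauville_structure (PSL 2 p) x1 y1 x2 y2 \<and>
      triple_type (PSL 2 p) (beauville_triple (PSL 2 p) x1 y1) = (nat r, nat r, nat r) \<and>
      triple_type (PSL 2 p) (beauville_triple (PSL 2 p) x2 y2) = (nat s, nat s, nat s))}"
  (is "infinite {p. prime p \<and> ?B p}")
proof -
  define m n where "m = nat r" and "n = nat s"
  have mn: "m \<ge> 6" "n \<ge> 6" "coprime m n"
    using assms by (auto simp: m_def n_def coprime_int_iff[symmetric] simp del: coprime_int_iff)
  have "\<exists>p > N. prime p \<and> ?B p" for N
  proof -
    \<comment> \<open>One residue serves both triples: \<open>a ^ n\<close> has order
      \<open>2 * m\<close> and \<open>a ^ m\<close> has order \<open>2 * n\<close>. The bound 2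
      makes \<open>p\<close> odd.\<close>
    obtain p a where p: "p > max N 2" "prime p" and a: "ord p a = 2 * m * n"
      using ex_large_prime_ord[of "2 * m * n" "max N 2"] mn by auto
    interpret odd_prime p by unfold_locales (use p in auto)
    have z1: "P dvd (int a ^ n) ^ k - 1 \<longleftrightarrow> 2 * m dvd k" for k
      using a mn by (intro cong_one_power_iff) auto
    have z2: "P dvd (int a ^ m) ^ k - 1 \<longleftrightarrow> 2 * n dvd k" for k
      using a mn by (intro cong_one_power_iff) auto
    obtain x1 y1 where 1: "x1 \<in> carrier Q" "y1 \<in> carrier Q" "generate Q {x1, y1} = carrier Q"
      "group.ord Q x1 = m" "group.ord Q y1 = m" "group.ord Q (inv\<^bsub>Q\<^esub> (x1 \<otimes>\<^bsub>Q\<^esub> y1)) = m"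
      using ex_generating_pair[OF mn(1) z1] .
    obtain x2 y2 where 2: "x2 \<in> carrier Q" "y2 \<in> carrier Q" "generate Q {x2, y2} = carrier Q"
      "group.ord Q x2 = n" "group.ord Q y2 = n" "group.ord Q (inv\<^bsub>Q\<^esub> (x2 \<otimes>\<^bsub>Q\<^esub> y2)) = n"
      using ex_generating_pair[OF mn(2) z2] .
    have "beauville_Sigma Q (beauville_triple Q x1 y1) \<inter> beauville_Sigma Q (beauville_triple Q x2 y2) = {\<one>\<^bsub>Q\<^esub>}"
      unfolding beauville_triple_def
      by (rule proj.H.beauville_Sigma_inter_eq_one) (use 1 2 mn in auto)
    then have ubs: "unmixed_beauville_structure Q x1 y1 x2 y2"
      using 1 2 finite_Q proj.H.is_group by (simp add: unmixed_beauville_structure_def)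
    have "?B p"
      by (rule exI[of _ x1], rule exI[of _ y1], rule exI[of _ x2], rule exI[of _ y2])
        (use ubs 1 2 in \<open>simp_all add: beauville_triple_def m_def n_def\<close>)
    moreover have "p > N" using p(1) by simp
    ultimately show ?thesis using p(2) by blast
  qed
  then show ?thesis by (simp add: infinite_nat_iff_unbounded)
qed

end
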